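(* Let $K$ be a number field with ring of integers $\mathcal{O}_K$, let $A\in K^{n\times n}$ be a matrix of rank $n$ with rows $A_1,\dots,A_n$, let $\mathfrak{a}_1,\dots,\mathfrak{a}_n$ be fractional ideals of $K$, and let $M=\mathfrak{a}_1A_1+\cdots+\mathfrak{a}_nA_n$. Assume $M\subseteq\mathcal{O}_K^n$, and let $\mathfrak{g}=\mathfrak{g}(M)=\det(A)\,\mathfrak{a}_1\cdots\mathfrak{a}_n$ be its determinantal ideal. Let $[(B_i),(\mathfrak{b}_i)]_{i\le n}$ be the HNF of $M$ modulo $\mathfrak{g}(M)$, i.e. the output of Algorithm H (described in the context) on input $A,\mathfrak{a}_1,\dots,\mathfrak{a}_n,\mathfrak{g}$, and let $[(W_i),(\mathfrak{c}_i)]_{i\le n}$ be the pseudo-basis obtained by applying Algorithm E (described in the context) to $B,\mathfrak{b}_1,\dots,\mathfrak{b}_n,\mathfrak{g}$. Then the $\mathcal{O}_K$-module defined by $[(W_i),(\mathfrak{c}_i)]_{i\le n}$ satisfies $$\mathfrak{c}_1W_1+\cdots+\mathfrak{c}_nW_n=M.$$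
   Context: A fractional ideal of $K$ is a nonzero finitely generated $\mathcal{O}_K$-submodule of $K$; it is integral if contained in $\mathcal{O}_K$; its denominator is the least integer $k>0$ such that $k$ times it is integral; $\mathcal{N}$ denotes the ideal norm. Let $d=[K:\mathbb{Q}]$, let $\Delta_K$ be the discriminant of $K$, and $\|x\|=\left(\sum_\sigma|\sigma(x)|^2\right)^{1/2}$, the sum being over the $d$ complex embeddings of $K$. LLL-reduced bases of fractional ideals are with respect to $\|\cdot\|$. For a matrix $B$, $B_i$ is its $i$-th row and $b_{i,j}$ its entries. Normalization of $(\mathfrak{a},A)$, where $\mathfrak{a}$ is a fractional ideal and $A\in K^n$: (1) replace $\mathfrak{a}$ by $k_0\mathfrak{a}$ and $A$ by $A/k_0$, where $k_0$ is the denominator of $\mathfrak{a}$; (2) put $\mathfrak{b}=k\mathfrak{a}^{-1}$ where $k$ is the denominator of $\mathfrak{a}^{-1}$; (3) let $\alpha$ be the first element of an LLL-reduced basis of $\mathfrak{b}$; (4) return $\mathfrak{a}'=(\alpha/k)\mathfrak{a}$ and $A'=(k/\alpha)A$. Reduction of $\alpha\in K$ modulo a fractional ideal $\mathfrak{a}$: if $\|\alpha\|\le d^{3/2}2^{d/2}\mathcal{N}(\mathfrak{a})^{1/d}\sqrt{|\Delta_K|}$ or $\alpha=1$, return $\alpha$. Otherwise compute an LLL-reduced basis $(r_i)_{i\le d}$ of $\mathfrak{a}$, write $\alpha=\sum_i x_ir_i$ with $x_i\in\mathbb{Q}$, and return $\alpha-\sum_i\lfloor x_i\rceil r_i$, where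 $\lfloor\cdot\rceil$ is rounding to a nearest integer. A vector is reduced by reducing each of its entries. Algorithm H (HNF of a full-rank square pseudo-matrix modulo $\mathfrak{g}$). Set $B=A$, $\mathfrak{b}_i=\mathfrak{a}_i$ and normalize every pair $(\mathfrak{b}_i,B_i)$. For $j=n,n-1,\dots,1$ and, for each $j$, for $i=j-1,j-2,\dots,1$, do the following: - put $\mathfrak{d}=b_{i,j}\mathfrak{b}_i+b_{j,j}\mathfrak{b}_j$; - find $u\in\mathfrak{b}_i\mathfrak{d}^{-1}$ and $v\in\mathfrak{b}_j\mathfrak{d}^{-1}$ such that $b_{i,j}u+b_{j,j}v=1$; - set $(B_i,B_j)\leftarrow(b_{j,j}B_i-b_{i,j}B_j,\;uB_i+vB_j)$; - set $(\mathfrak{b}_i,\mathfrak{b}_j)\leftarrow(b_{i,j}\mathfrak{b}_i\,b_{j,j}\mathfrak{b}_j\,\mathfrak{d}^{-1},\;\mathfrak{d})$; - normalize $(\mathfrak{b}_i,B_i)$; - reduce $B_i$ modulo $\mathfrak{g}\mathfrak{b}_i^{-1}$ and $B_j$ modulo $\mathfrak{g}\mathfrak{b}_j^{-1}$. Return $(\mathfrak{b}_i)_{i\le n}$ and $B$. Algorithm E (Euclidean reconstruction of the HNF). Set $\mathfrak{g}_n=\mathfrak{g}$. For $j=n,n-1,\dots,1$: put $\mathfrak{c}_j=\mathfrak{b}_j+\mathfrak{g}_j$; find $u\in\mathfrak{b}_j\mathfrak{c}_j^{-1}$ and $v\in\mathfrak{g}_j\mathfrak{c}_j^{-1}$ such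 that $u+v=1$; set $W_j=uB_j \bmod \mathfrak{g}_j\mathfrak{c}_j^{-1}$ (entries reduced modulo this fractional ideal, the diagonal entry of $W_j$ being required to be $1$); put $\mathfrak{g}_{j-1}=\mathfrak{g}_j\mathfrak{c}_j^{-1}$. Return $W$ (with rows $W_j$) and $(\mathfrak{c}_j)_{j\le n}$.
   Formalization: In Algorithm H the ideal update is corrected to (b_i b_j d^-1, d), as the printed one makes the claim false; in Algorithm E the diagonal entry 1 must be congruent to u b_{j,j} mod g_j c_j^-1, else there is no output (in row 1 this forces c_1 = g_1). *)

theory Defs
  imports
    "HOL-Computational_Algebra.Polynomial"
    "HOL-Library.Set_Algebras"
    "Jordan_Normal_Form.DL_Rank"
begin

section \<open>Number fields\<close>

text \<open>
  A number field is modelled as a type of sort \<open>field_char_0\<close> (so that it contains a unique copy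
  of the rationals) which is finite-dimensional over the rationals.
\<close>

definition rat_scale :: "rat \<Rightarrow> 'k::field_char_0 \<Rightarrow> 'k" where
  "rat_scale q x = of_rat q * x"

interpretation rat_vs: vector_space "rat_scale :: rat \<Rightarrow> 'k::field_char_0 \<Rightarrow> 'k"
  by unfold_locales (simp_all add: rat_scale_def algebra_simps of_rat_add of_rat_mult)

definition number_field :: "'k::field_char_0 itself \<Rightarrow> bool" where
  "number_field _ \<longleftrightarrow>
     (\<exists>Basis. finite_dimensional_vector_space (rat_scale :: rat \<Rightarrow> 'k \<Rightarrow> 'k) Basis)"

definition field_degree :: "'k::field_char_0 itself \<Rightarrow> nat" where
  "field_degree _ = rat_vs.dim (UNIV :: 'k set)"

definition ring_of_integers :: "'k::field_char_0 set" where
  "ring_of_integers = {x. algebraic_int x}"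

definition embeddings :: "('k::field_char_0 \<Rightarrow> complex) set" where
  "embeddings = {\<sigma>. field_hom \<sigma>}"

definition field_trace :: "'k::field_char_0 \<Rightarrow> complex" where
  "field_trace x = (\<Sum>\<sigma>\<in>embeddings. \<sigma> x)"

definition T2_norm :: "'k::field_char_0 \<Rightarrow> real" where
  "T2_norm x = sqrt (\<Sum>\<sigma>\<in>embeddings. (cmod (\<sigma> x))\<^sup>2)"

text \<open>A \<open>\<int>\<close>-basis of \<open>L\<close> is given by the values of \<open>r\<close> at the indices below \<open>[K:\<rat>]\<close>.\<close>

definition Z_basis :: "(nat \<Rightarrow> 'k::field_char_0) \<Rightarrow> 'k set \<Rightarrow> bool" where
  "Z_basis r L \<longleftrightarrow>
     L = range (\<lambda>c::nat \<Rightarrow> int. \<Sum>i<field_degree TYPE('k). of_int (c i) * r i) \<and>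
     (\<forall>c::nat \<Rightarrow> int. (\<Sum>i<field_degree TYPE('k). of_int (c i) * r i) = 0 \<longrightarrow>
        (\<forall>i<field_degree TYPE('k). c i = 0))"

definition field_discriminant :: "'k::field_char_0 itself \<Rightarrow> int" where
  "field_discriminant _ =
     (THE D. \<exists>w :: nat \<Rightarrow> 'k. Z_basis w ring_of_integers \<and>
        of_int D = det (mat (field_degree TYPE('k)) (field_degree TYPE('k))
                          (\<lambda>(i, j). field_trace (w i * w j))))"


section \<open>Fractional ideals\<close>

definition fractional_ideal :: "'k::field_char_0 set \<Rightarrow> bool" where
  "fractional_ideal I \<longleftrightarrow> I \<noteq> {0} \<and>
     (\<exists>S. finite S \<and> I = {\<Sum>s\<in>S. c s * s | c. \<forall>s\<in>S. c s \<in> ring_of_integers})"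

text \<open>
  Sums of ideals and multiples of an ideal by a field element are \<open>I + J\<close> and \<open>x *o I\<close> from
  \<open>Set_Algebras\<close>. The elementwise product \<open>I * J\<close> of that theory is not the ideal product.
\<close>

definition ideal_mult :: "'k::field_char_0 set \<Rightarrow> 'k set \<Rightarrow> 'k set"  (infixl \<open>\<cdot>\<^sub>I\<close> 70) where
  "I \<cdot>\<^sub>I J = {\<Sum>l<(m::nat). x l * y l | m x y. \<forall>l<m. x l \<in> I \<and> y l \<in> J}"

definition ideal_inverse :: "'k::field_char_0 set \<Rightarrow> 'k set" where
  "ideal_inverse I = {x. \<forall>a\<in>I. x * a \<in> ring_of_integers}"

definition ideal_prod :: "nat \<Rightarrow> (nat \<Rightarrow> 'k::field_char_0 set) \<Rightarrow> 'k set" where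
  "ideal_prod n I = foldr (\<lambda>i J. I i \<cdot>\<^sub>I J) [0..<n] ring_of_integers"

definition denominator :: "'k::field_char_0 set \<Rightarrow> nat" where
  "denominator I = (LEAST k. k > 0 \<and> of_nat k *o I \<subseteq> ring_of_integers)"

definition integral_ideal_norm :: "'k::field_char_0 set \<Rightarrow> nat" where
  "integral_ideal_norm I =
     card (ring_of_integers // {(x, y). x \<in> ring_of_integers \<and> y \<in> ring_of_integers \<and> x - y \<in> I})"

definition ideal_norm :: "'k::field_char_0 set \<Rightarrow> real" where
  "ideal_norm I = real (integral_ideal_norm (of_nat (denominator I) *o I)) /
                  real (denominator I) ^ field_degree TYPE('k)"


section \<open>LLL-reduced bases\<close>

text \<open>
  Gram--Schmidt orthogonalization takes place in the real vector space spanned by the images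
  \<open>(\<sigma> x)\<^sub>\<sigma>\<close> of field elements, with the real inner product inducing \<^const>\<open>T2_norm\<close>.
\<close>

definition emb_inner :: "(('k::field_char_0 \<Rightarrow> complex) \<Rightarrow> complex) \<Rightarrow> (('k \<Rightarrow> complex) \<Rightarrow> complex) \<Rightarrow> real" where
  "emb_inner x y = Re (\<Sum>\<sigma>\<in>embeddings. x \<sigma> * cnj (y \<sigma>))"

fun GSO :: "(nat \<Rightarrow> 'k::field_char_0) \<Rightarrow> nat \<Rightarrow> ('k \<Rightarrow> complex) \<Rightarrow> complex" where
  "GSO r i = (\<lambda>\<sigma>. \<sigma> (r i) -
     (\<Sum>j<i. complex_of_real (emb_inner (\<lambda>\<tau>. \<tau> (r i)) (GSO r j) / emb_inner (GSO r j) (GSO r j)) *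
            GSO r j \<sigma>))"

declare GSO.simps [simp del]

definition GSO_coeff :: "(nat \<Rightarrow> 'k::field_char_0) \<Rightarrow> nat \<Rightarrow> nat \<Rightarrow> real" where
  "GSO_coeff r i j = emb_inner (\<lambda>\<tau>. \<tau> (r i)) (GSO r j) / emb_inner (GSO r j) (GSO r j)"

text \<open>The Lovasz condition is the original one, with parameter \<open>3/4\<close>.\<close>

definition LLL_reduced_basis :: "(nat \<Rightarrow> 'k::field_char_0) \<Rightarrow> 'k set \<Rightarrow> bool" where
  "LLL_reduced_basis r L \<longleftrightarrow>
     Z_basis r L \<and>
     (\<forall>i<field_degree TYPE('k). \<forall>j<i. \<bar>GSO_coeff r i j\<bar> \<le> 1 / 2) \<and>
     (\<forall>i. 0 < i \<and> i < field_degree TYPE('k) \<longrightarrow>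
        emb_inner (GSO r i) (GSO r i) \<ge>
          (3 / 4 - (GSO_coeff r i (i - 1))\<^sup>2) * emb_inner (GSO r (i - 1)) (GSO r (i - 1)))"


section \<open>Pseudo-matrices, normalization and reduction\<close>

text \<open>
  Indices are 0-based. LLL-reduced bases, Bezout coefficients and roundings of half-integers
  are not unique, so the procedures below are relations between inputs and possible outputs.
\<close>

definition pseudo_span :: "nat \<Rightarrow> (nat \<Rightarrow> 'k::field_char_0 set) \<Rightarrow> 'k mat \<Rightarrow> 'k vec set" where
  "pseudo_span n I A =
     {vec n (\<lambda>k. \<Sum>i<n. x i * A $$ (i, k)) | x. \<forall>i<n. x i \<in> I i}"

definition integral_vecs :: "nat \<Rightarrow> 'k::field_char_0 vec set" where
  "integral_vecs n = {v \<in> carrier_vec n. \<forall>k<n. v $ k \<in> ring_of_integers}"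

definition normalizes ::
  "'k::field_char_0 set \<Rightarrow> 'k vec \<Rightarrow> 'k set \<Rightarrow> 'k vec \<Rightarrow> bool" where
  "normalizes I v I' v' \<longleftrightarrow>
     (let k0 = of_nat (denominator I);
          I1 = k0 *o I;
          v1 = inverse k0 \<cdot>\<^sub>v v;
          k = of_nat (denominator (ideal_inverse I1));
          J = k *o ideal_inverse I1
      in \<exists>r. LLL_reduced_basis r J \<and>
             I' = (r 0 / k) *o I1 \<and>
             v' = (k / r 0) \<cdot>\<^sub>v v1)"

definition reduction_bound :: "'k::field_char_0 set \<Rightarrow> real" where
  "reduction_bound I =
     (let d = real (field_degree TYPE('k))
      in d powr (3 / 2) * 2 powr (d / 2) * ideal_norm I powr (1 / d) *
         sqrt \<bar>real_of_int (field_discriminant TYPE('k))\<bar>)"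

definition reduces :: "'k::field_char_0 set \<Rightarrow> 'k \<Rightarrow> 'k \<Rightarrow> bool" where
  "reduces I a b \<longleftrightarrow>
     (if T2_norm a \<le> reduction_bound I \<or> a = 1 then b = a
      else \<exists>r (x :: nat \<Rightarrow> rat) (m :: nat \<Rightarrow> int).
             LLL_reduced_basis r I \<and>
             a = (\<Sum>i<field_degree TYPE('k). of_rat (x i) * r i) \<and>
             (\<forall>i<field_degree TYPE('k). \<bar>x i - of_int (m i)\<bar> \<le> 1 / 2) \<and>
             b = a - (\<Sum>i<field_degree TYPE('k). of_int (m i) * r i))"

definition reduces_vec :: "'k::field_char_0 set \<Rightarrow> 'k vec \<Rightarrow> 'k vec \<Rightarrow> bool" where
  "reduces_vec I v w \<longleftrightarrow> dim_vec w = dim_vec v \<and> (\<forall>k<dim_vec v. reduces I (v $ k) (w $ k))"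


section \<open>Hermite normal form modulo an ideal\<close>

text \<open>
  One pass of the inner loop, for the pivot column (and row) \<open>j\<close> and the row \<open>i\<close>. The
  transformation of the two rows has determinant \<open>p u + q v = 1\<close>, so the ideal that goes with the
  row \<open>q B\<^sub>i - p B\<^sub>j\<close> and keeps \<open>\<bb>\<^sub>i B\<^sub>i + \<bb>\<^sub>j B\<^sub>j\<close> unchanged is \<open>\<bb>\<^sub>i \<bb>\<^sub>j \<dd>\<^sup>-\<^sup>1\<close>. In the literature it also
  appears as \<open>(p \<bb>\<^sub>i) (q \<bb>\<^sub>j) \<dd>\<^sup>-\<^sup>1\<close>; this is a slip, because that ideal belongs to the row
  \<open>B\<^sub>i / p - B\<^sub>j / q\<close>. Paired with \<open>q B\<^sub>i - p B\<^sub>j\<close> it changes the module.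
\<close>

definition hnf_step ::
  "nat \<Rightarrow> 'k::field_char_0 set \<Rightarrow> nat \<times> nat \<Rightarrow>
   'k mat \<times> (nat \<Rightarrow> 'k set) \<Rightarrow> 'k mat \<times> (nat \<Rightarrow> 'k set) \<Rightarrow> bool" where
  "hnf_step n \<gg> = (\<lambda>(j, i) (B, \<bb>) (B', \<bb>').
     let p = B $$ (i, j); q = B $$ (j, j); \<dd> = p *o \<bb> i + q *o \<bb> j in
     \<exists>u v R.
       u \<in> \<bb> i \<cdot>\<^sub>I ideal_inverse \<dd> \<and> v \<in> \<bb> j \<cdot>\<^sub>I ideal_inverse \<dd> \<and> p * u + q * v = 1 \<and>
       normalizes (\<bb> i \<cdot>\<^sub>I \<bb> j \<cdot>\<^sub>I ideal_inverse \<dd>) (q \<cdot>\<^sub>v row B i - p \<cdot>\<^sub>v row B j) (\<bb>' i) R \<and>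
       \<bb>' j = \<dd> \<and>
       (\<forall>l. l \<noteq> i \<and> l \<noteq> j \<longrightarrow> \<bb>' l = \<bb> l) \<and>
       B' \<in> carrier_mat n n \<and>
       reduces_vec (\<gg> \<cdot>\<^sub>I ideal_inverse (\<bb>' i)) R (row B' i) \<and>
       reduces_vec (\<gg> \<cdot>\<^sub>I ideal_inverse (\<bb>' j)) (u \<cdot>\<^sub>v row B i + v \<cdot>\<^sub>v row B j) (row B' j) \<and>
       (\<forall>l<n. l \<noteq> i \<and> l \<noteq> j \<longrightarrow> row B' l = row B l))"

primrec hnf_steps ::
  "nat \<Rightarrow> 'k::field_char_0 set \<Rightarrow> (nat \<times> nat) list \<Rightarrow>
   'k mat \<times> (nat \<Rightarrow> 'k set) \<Rightarrow> 'k mat \<times> (nat \<Rightarrow> 'k set) \<Rightarrow> bool" where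
  "hnf_steps n \<gg> [] s s' \<longleftrightarrow> s' = s"
| "hnf_steps n \<gg> (ji # jis) s s' \<longleftrightarrow> (\<exists>t. hnf_step n \<gg> ji s t \<and> hnf_steps n \<gg> jis t s')"

definition hnf_modulo ::
  "nat \<Rightarrow> 'k::field_char_0 mat \<Rightarrow> (nat \<Rightarrow> 'k set) \<Rightarrow> 'k set \<Rightarrow>
   'k mat \<Rightarrow> (nat \<Rightarrow> 'k set) \<Rightarrow> bool" where
  "hnf_modulo n A \<aa> \<gg> B \<bb> \<longleftrightarrow>
     (\<exists>B0 \<bb>0. B0 \<in> carrier_mat n n \<and>
        (\<forall>i<n. normalizes (\<aa> i) (row A i) (\<bb>0 i) (row B0 i)) \<and>
        hnf_steps n \<gg> [(j, i). j \<leftarrow> rev [0..<n], i \<leftarrow> rev [0..<j]] (B0, \<bb>0) (B, \<bb>))"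

text \<open>
  \<open>G (Suc j)\<close> and \<open>G j\<close> are the ideals \<open>\<gg>\<close> before and after the step that treats row \<open>j\<close>. The
  diagonal entry has to be chosen to be \<open>1\<close> within its residue class: this is a condition on
  \<open>u B\<^sub>j\<^sub>j\<close>, not an assignment that discards \<open>u B\<^sub>j\<^sub>j\<close>.
\<close>

definition euclidean_reconstruction ::
  "nat \<Rightarrow> 'k::field_char_0 mat \<Rightarrow> (nat \<Rightarrow> 'k set) \<Rightarrow> 'k set \<Rightarrow>
   'k mat \<Rightarrow> (nat \<Rightarrow> 'k set) \<Rightarrow> bool" where
  "euclidean_reconstruction n B \<bb> \<gg> W \<cc> \<longleftrightarrow> W \<in> carrier_mat n n \<and>
     (\<exists>G. G n = \<gg> \<and>
       (\<forall>j<n. \<cc> j = \<bb> j + G (Suc j) \<and>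
              G j = G (Suc j) \<cdot>\<^sub>I ideal_inverse (\<cc> j) \<and>
              (\<exists>u v. u \<in> \<bb> j \<cdot>\<^sub>I ideal_inverse (\<cc> j) \<and>
                     v \<in> G (Suc j) \<cdot>\<^sub>I ideal_inverse (\<cc> j) \<and>
                     u + v = 1 \<and>
                     (\<forall>k<n. k \<noteq> j \<longrightarrow> reduces (G j) (u * B $$ (j, k)) (W $$ (j, k))) \<and>
                     W $$ (j, j) = 1 \<and> u * B $$ (j, j) - 1 \<in> G j)))"

end

theory Submission
  imports Defs "Jordan_Normal_Form.Char_Poly"
begin

text \<open>
  Write \<open>M\<close> for the module spanned by the input and \<open>O\<close> for the ring of integers. By Cramer's rule
  \<open>\<gg> O\<^sup>n \<subseteq> M\<close>, so every pass of Algorithm H preserves the identity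
  \<open>M = \<Sum> \<bb>\<^sub>i B\<^sub>i + \<gg> O\<^sup>n\<close>; at the end \<open>B\<close> is lower triangular with pivots \<open>1\<close>, except possibly in row \<open>0\<close>.

  Algorithm E is treated by downward induction on \<open>j\<close>. The claim is that \<open>M\<close> is the sum of the
  \<open>\<bb>\<^sub>i B\<^sub>i\<close> with \<open>i < j\<close>, of \<open>G\<^sub>j O\<^sup>j\<close>, and of the \<open>\<cc>\<^sub>l W\<^sub>l\<close> with \<open>l \<ge> j\<close>. Since \<open>M\<close> is integral, it is contained
  in the sum \<open>L\<close> of \<open>O\<^sup>j\<close> and the \<open>\<cc>\<^sub>l W\<^sub>l\<close> with \<open>l \<ge> j\<close>, whose determinantal ideal is the product of these
  \<open>\<cc>\<^sub>l\<close>. The quotient of the two determinantal ideals is \<open>G\<^sub>j\<close>, so Cramer's rule gives \<open>G\<^sub>j L \<subseteq> M\<close>, hence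
  \<open>G\<^sub>j O\<^sup>j \<subseteq> M\<close>. For \<open>j = 0\<close> the same comparison of determinants, applied to the submodule of \<open>M\<close> spanned by
  \<open>\<bb>\<^sub>0 B\<^sub>0\<close> and the \<open>\<cc>\<^sub>l W\<^sub>l\<close> with \<open>l > 0\<close>, shows that the first entries of \<open>\<bb>\<^sub>0 B\<^sub>0\<close> lie in \<open>G\<^sub>1 \<subseteq> \<cc>\<^sub>0\<close>.

  No unique factorization of ideals is needed: the only ideals that have to be invertible are the
  \<open>\<cc>\<^sub>j\<close>, and the Bezout relation \<open>u + v = 1\<close> already exhibits \<open>1\<close> in \<open>\<cc>\<^sub>j \<cc>\<^sub>j\<^sup>-\<^sup>1\<close>.
\<close>

section \<open>Algebraic integers\<close>

text \<open>Determinant trick: multiplication by \<open>x\<close> on the generators is given by an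
  integer matrix, the generators form an eigenvector for \<open>x\<close>, and the characteristic
  polynomial is monic with integer coefficients. A nonzero generator is required because an
  eigenvector must not vanish.\<close>

lemma algebraic_int_of_stable_span:
  fixes V :: "'k::field_char_0 set"
  assumes "finite V" and "\<exists>v\<in>V. v \<noteq> 0"
    and stable: "\<And>v. v \<in> V \<Longrightarrow> \<exists>c::'k \<Rightarrow> int. x * v = (\<Sum>w\<in>V. of_int (c w) * w)"
  shows "algebraic_int x"
proof -
  obtain c :: "'k \<Rightarrow> 'k \<Rightarrow> int" where c: "\<And>v. v \<in> V \<Longrightarrow> x * v = (\<Sum>w\<in>V. of_int (c v w) * w)"
    using stable by metis
  define N where "N = card V"
  obtain h where h: "bij_betw h {..<N} V"
    using ex_bij_betw_nat_finite[OF \<open>finite V\<close>] by (auto simp: N_def lessThan_atLeast0)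
  define M :: "int mat" where "M = mat N N (\<lambda>(i, j). c (h i) (h j))"
  define M' :: "'k mat" where "M' = map_mat of_int M"
  define v where "v = vec N h"
  have M: "M \<in> carrier_mat N N" and M': "M' \<in> carrier_mat N N"
    by (auto simp: M_def M'_def)
  have hV: "h i \<in> V" if "i < N" for i using h that by (auto simp: bij_betw_def)
  have "M' *\<^sub>v v = x \<cdot>\<^sub>v v"
  proof (rule eq_vecI)
    fix i assume "i < dim_vec (x \<cdot>\<^sub>v v)"
    then have i: "i < N" by (simp add: v_def)
    have "(M' *\<^sub>v v) $ i = (\<Sum>j<N. of_int (c (h i) (h j)) * h j)"
      using i by (simp add: M'_def M_def v_def scalar_prod_def atLeast0LessThan)
    also have "\<dots> = x * h i"
      using sum.reindex_bij_betw[OF h, of "\<lambda>w. of_int (c (h i) w) * w"] c[OF hV[OF i]] by simp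
    finally show "(M' *\<^sub>v v) $ i = (x \<cdot>\<^sub>v v) $ i" using i by (simp add: v_def)
  qed (simp add: M'_def M_def v_def)
  moreover have "v \<noteq> 0\<^sub>v N"
  proof
    assume z: "v = 0\<^sub>v N"
    obtain w where w: "w \<in> V" "w \<noteq> 0" using assms(2) by blast
    then obtain i where "i < N" "w = h i" using h by (auto simp: bij_betw_def)
    then show False using z w by (metis index_vec index_zero_vec(1) v_def)
  qed
  ultimately have "eigenvalue M' x"
    using M' unfolding eigenvalue_def eigenvector_def by (intro exI[of _ v]) (simp add: v_def)
  then have "poly (char_poly M') x = 0"
    using eigenvalue_root_char_poly[OF M'] by simp
  then have "poly (map_poly of_int (char_poly M)) x = 0"
    unfolding M'_def of_int_hom.char_poly_hom[OF M] .
  moreover have "lead_coeff (char_poly M) = 1"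
    using degree_monic_char_poly[OF M] by simp
  ultimately show ?thesis by (auto simp: algebraic_int_altdef_ipoly)
qed

text \<open>Makes the library's \<open>span\<close> available over the integers for the closure
  proof below.\<close>

lemma int_module: "module (\<lambda>(n::int) (x::'k::ring_1). of_int n * x)"
  by unfold_locales (simp_all add: algebra_simps)

lemma algebraic_int_power_relation:
  fixes x :: "'k::field_char_0"
  assumes "algebraic_int x"
  obtains m c where "0 < m" and "x ^ m = (\<Sum>k<m. of_int (c k) * x ^ k)"
proof -
  obtain p :: "int poly" where p: "poly (map_poly of_int p) x = 0" "lead_coeff p = 1"
    using assms by (auto simp: algebraic_int_altdef_ipoly)
  define m where "m = degree p"
  have "(\<Sum>k\<le>m. of_int (coeff p k) * x ^ k) = 0"
    using p by (simp add: poly_altdef m_def)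
  moreover have "{..m} = insert m {..<m}" by auto
  ultimately have "x ^ m + (\<Sum>k<m. of_int (coeff p k) * x ^ k) = 0"
    using p(2) by (simp add: m_def)
  then have eq: "x ^ m = - (\<Sum>k<m. of_int (coeff p k) * x ^ k)"
    by (simp only: eq_neg_iff_add_eq_0)
  moreover have "m \<noteq> 0"
  proof
    assume "m = 0"
    then show False using eq by simp
  qed
  ultimately show ?thesis using that[of m "\<lambda>k. - coeff p k"] by (simp add: sum_negf)
qed

text \<open>The monomials \<open>x ^ i * y ^ j\<close> below the degrees of two monic relations span
  a group stable under \<open>x\<close> and \<open>y\<close>, since an overflowing power is
  rewritten by its relation. The determinant trick then applies to sum and product.\<close>

lemma algebraic_int_plus_times:
  fixes x y :: "'k::field_char_0"
  assumes "algebraic_int x" and "algebraic_int y"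
  shows "algebraic_int (x + y)" and "algebraic_int (x * y)"
proof -
  interpret Z: module "\<lambda>(n::int) (x::'k). of_int n * x" by (rule int_module)
  obtain m c where m: "0 < m" "x ^ m = (\<Sum>k<m. of_int (c k) * x ^ k)"
    using algebraic_int_power_relation[OF assms(1)] by blast
  obtain l d where l: "0 < l" "y ^ l = (\<Sum>k<l. of_int (d k) * y ^ k)"
    using algebraic_int_power_relation[OF assms(2)] by blast
  define V where "V = (\<lambda>(i, j). x ^ i * y ^ j) ` ({..<m} \<times> {..<l})"
  have fin: "finite V" by (simp add: V_def)
  have VI: "x ^ i * y ^ j \<in> V" if "i < m" "j < l" for i j
    using that by (auto simp: V_def)
  have x1: "x * v \<in> Z.span V" if v: "v \<in> V" for v
  proof -
    obtain i j where ij: "i < m" "j < l" "v = x ^ i * y ^ j" using v by (auto simp: V_def)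
    show ?thesis
    proof (cases "Suc i = m")
      case True
      then have "x * v = x ^ m * y ^ j" by (simp add: ij flip: True)
      also have "\<dots> = (\<Sum>k<m. of_int (c k) * (x ^ k * y ^ j))"
        by (simp add: m(2) sum_distrib_right mult.assoc)
      also have "\<dots> \<in> Z.span V" 
        using ij VI by (intro Z.span_sum Z.span_scale Z.span_base) auto
      finally show ?thesis .
    next
      case False
      then show ?thesis using VI[of "Suc i" j] ij by (simp add: Z.span_base mult.assoc)
    qed
  qed
  have y1: "y * v \<in> Z.span V" if v: "v \<in> V" for v
  proof -
    obtain i j where ij: "i < m" "j < l" "v = x ^ i * y ^ j" using v by (auto simp: V_def)
    show ?thesis
    proof (cases "Suc j = l")
      case True
      then have "y * v = x ^ i * y ^ l" by (simp add: ij flip: True)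
      also have "\<dots> = (\<Sum>k<l. of_int (d k) * (x ^ i * y ^ k))"
        by (simp add: l(2) sum_distrib_left mult.left_commute)
      also have "\<dots> \<in> Z.span V" 
        using ij VI by (intro Z.span_sum Z.span_scale Z.span_base) auto
      finally show ?thesis .
    next
      case False
      then show ?thesis using VI[of i "Suc j"] ij by (simp add: Z.span_base mult.left_commute)
    qed
  qed
  \<comment> \<open>For the product, \<open>y * v\<close> is only known to lie in the span, so
    stability under \<open>x\<close> has to be extended from generators to the span.\<close>
  have x2: "x * v \<in> Z.span V" if "v \<in> Z.span V" for v
    using that
  proof (induction rule: Z.span_induct_alt)
    case (step n a b)
    have "x * (of_int n * a + b) = of_int n * (x * a) + x * b" by (simp add: algebra_simps)
    then show ?case using step x1 by (simp add: Z.span_add Z.span_scale)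
  qed (simp add: Z.span_zero)
  have one: "\<exists>v\<in>V. v \<noteq> 0" using VI[OF m(1) l(1)] by (intro bexI[of _ 1]) simp_all
  have *: "algebraic_int z" if "\<And>v. v \<in> V \<Longrightarrow> z * v \<in> Z.span V" for z
    using that by (intro algebraic_int_of_stable_span[OF fin one]) (auto simp: Z.span_finite[OF fin])
  show "algebraic_int (x + y)"
    by (rule *) (simp add: distrib_right Z.span_add x1 y1)
  show "algebraic_int (x * y)"
    by (rule *) (simp add: mult.assoc x2 y1)
qed

text \<open>Clearing the denominators in the matrix of multiplication by \<open>x\<close> on a
  rational basis yields a multiple of \<open>x\<close> that stabilizes the integral span of this
  basis.\<close>

lemma number_field_algebraic_int_multiple:
  fixes x :: "'k::field_char_0"
  assumes "number_field TYPE('k)"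
  obtains m :: nat where "0 < m" and "of_nat m * x \<in> ring_of_integers"
proof -
  obtain V where "finite_dimensional_vector_space (rat_scale :: rat \<Rightarrow> 'k \<Rightarrow> 'k) V"
    using assms by (auto simp: number_field_def)
  then interpret V: finite_dimensional_vector_space "rat_scale :: rat \<Rightarrow> 'k \<Rightarrow> 'k" V .
  have fin: "finite V" by (rule V.finite_Basis)
  have sp: "\<exists>q. z = (\<Sum>w\<in>V. of_rat (q w) * w)" for z
  proof -
    have "z \<in> range (\<lambda>q. \<Sum>w\<in>V. rat_scale (q w) w)"
      by (simp only: rat_vs.span_finite[OF fin, symmetric] V.span_Basis UNIV_I)
    then show ?thesis by (simp only: image_iff rat_scale_def bex_UNIV)
  qed
  then obtain q where q: "\<And>z. z = (\<Sum>w\<in>V. of_rat (q z w) * w)" by metis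
  \<comment> \<open>Product of the denominators of all coordinates of all \<open>x * v\<close> with
    \<open>v\<close> in the basis.\<close>
  define D where "D = (\<Prod>(v, w)\<in>V \<times> V. snd (quotient_of (q (x * v) w)))"
  have Dpos: "D > 0"
    unfolding D_def by (intro prod_pos) (auto intro: quotient_of_denom_pos')
  have Dq: "\<exists>c::int. of_int D * q (x * v) w = of_int c" if "v \<in> V" "w \<in> V" for v w
  proof -
    define r where "r = q (x * v) w"
    obtain a b where ab: "quotient_of r = (a, b)" by (cases "quotient_of r")
    have "b dvd D"
      using that fin ab dvd_prodI[of "V \<times> V" "(v, w)" "\<lambda>(v, w). snd (quotient_of (q (x * v) w))"]
      by (simp add: D_def r_def)
    then obtain e where e: "D = b * e" by blast
    have "b > 0" using quotient_of_denom_pos[OF ab] .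
    then have "of_int D * r = of_int (e * a)"
      using quotient_of_div[OF ab] by (simp add: e)
    then show ?thesis unfolding r_def by blast
  qed
  then obtain c :: "'k \<Rightarrow> 'k \<Rightarrow> int" where c: "\<And>v w. v \<in> V \<Longrightarrow> w \<in> V \<Longrightarrow> of_int D * q (x * v) w = of_int (c v w)"
    by metis
  have "algebraic_int (of_int D * x)"
  proof (rule algebraic_int_of_stable_span[OF fin])
    show "\<exists>v\<in>V. v \<noteq> 0"
    proof (rule ccontr)
      assume "\<not> ?thesis"
      then have "(\<Sum>w\<in>V. of_rat (q 1 w) * w) = 0" by (intro sum.neutral) auto
      then show False using q[of 1] by (metis zero_neq_one)
    qed
    fix v assume v: "v \<in> V"
    have "of_int D * x * v = of_int D * (\<Sum>w\<in>V. of_rat (q (x * v) w) * w)"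
      by (simp only: q[of "x * v", symmetric] mult.assoc)
    also have "\<dots> = (\<Sum>w\<in>V. of_rat (of_int D * q (x * v) w) * w)"
      by (simp add: sum_distrib_left of_rat_mult mult.assoc)
    also have "\<dots> = (\<Sum>w\<in>V. of_int (c v w) * w)"
      using c v by (intro sum.cong) auto
    finally show "\<exists>c::'k \<Rightarrow> int. of_int D * x * v = (\<Sum>w\<in>V. of_int (c w) * w)" by blast
  qed
  then show ?thesis
    using Dpos that[of "nat D"] by (simp add: ring_of_integers_def)
qed

text \<open>Ensures that a \<open>Z_basis\<close> really has an element with index 0, the one that
  normalization divides by.\<close>

lemma number_field_degree_pos:
  assumes "number_field TYPE('k::field_char_0)"
  shows "0 < field_degree TYPE('k)"
proof -
  obtain V where "finite_dimensional_vector_space (rat_scale :: rat \<Rightarrow> 'k \<Rightarrow> 'k) V"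
    using assms by (auto simp: number_field_def)
  then interpret V: finite_dimensional_vector_space "rat_scale :: rat \<Rightarrow> 'k \<Rightarrow> 'k" V .
  have "rat_vs.dim (UNIV :: 'k set) = card V"
    using V.dim_UNIV V.dimension_def by simp
  moreover have "V \<noteq> {}"
  proof
    assume "V = {}"
    then have "(1::'k) \<in> rat_vs.span {}" using V.span_Basis by auto
    then show False by simp
  qed
  ultimately show ?thesis
    using V.finite_Basis by (simp add: field_degree_def card_gt_0_iff)
qed

section \<open>Modules over the ring of integers\<close>

lemma ring_of_integers_0 [simp]: "0 \<in> ring_of_integers"
  and ring_of_integers_1 [simp]: "1 \<in> ring_of_integers"
  by (simp_all add: ring_of_integers_def)

lemma ring_of_integers_add: "x \<in> ring_of_integers \<Longrightarrow> y \<in> ring_of_integers \<Longrightarrow> x + y \<in> ring_of_integers"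
  and ring_of_integers_mult: "x \<in> ring_of_integers \<Longrightarrow> y \<in> ring_of_integers \<Longrightarrow> x * y \<in> ring_of_integers"
  by (simp_all add: ring_of_integers_def algebraic_int_plus_times)

lemma ring_of_integers_of_nat [simp]: "of_nat m \<in> ring_of_integers"
  by (simp add: ring_of_integers_def)

lemma ring_of_integers_neg_1: "- 1 \<in> ring_of_integers"
  by (simp add: ring_of_integers_def)

definition integer_module :: "'k::field_char_0 set \<Rightarrow> bool" where
  "integer_module I \<longleftrightarrow> 0 \<in> I \<and> (\<forall>x\<in>I. \<forall>y\<in>I. x + y \<in> I) \<and> (\<forall>r\<in>ring_of_integers. \<forall>x\<in>I. r * x \<in> I)"

lemma integer_module_0: "integer_module I \<Longrightarrow> 0 \<in> I"
  and integer_module_add: "integer_module I \<Longrightarrow> x \<in> I \<Longrightarrow> y \<in> I \<Longrightarrow> x + y \<in> I"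
  and integer_module_mult: "integer_module I \<Longrightarrow> r \<in> ring_of_integers \<Longrightarrow> x \<in> I \<Longrightarrow> r * x \<in> I"
  by (simp_all add: integer_module_def)

lemma integer_module_mult_right:
  "integer_module I \<Longrightarrow> r \<in> ring_of_integers \<Longrightarrow> x \<in> I \<Longrightarrow> x * r \<in> I"
  using integer_module_mult[of I r x] by (simp add: mult.commute)

lemma integer_module_uminus: "integer_module I \<Longrightarrow> x \<in> I \<Longrightarrow> - x \<in> I"
  using integer_module_mult[OF _ ring_of_integers_neg_1, of I x] by simp

lemma integer_module_diff: "integer_module I \<Longrightarrow> x \<in> I \<Longrightarrow> y \<in> I \<Longrightarrow> x - y \<in> I"
  using integer_module_add[of I x "- y"] integer_module_uminus[of I y] by simp

lemma integer_module_sum: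
  assumes "integer_module I" and "\<And>i. i \<in> A \<Longrightarrow> f i \<in> I"
  shows "sum f A \<in> I"
  using assms(2) by (induction A rule: infinite_finite_induct)
    (simp_all add: assms(1) integer_module_0 integer_module_add)

lemma integer_module_ring_of_integers: "integer_module ring_of_integers"
  by (simp add: integer_module_def ring_of_integers_add ring_of_integers_mult)

lemma ring_of_integers_prod:
  assumes "\<And>i. i \<in> A \<Longrightarrow> f i \<in> ring_of_integers"
  shows "prod f A \<in> ring_of_integers"
  using assms by (induction A rule: infinite_finite_induct) (simp_all add: ring_of_integers_mult)

lemma integer_module_scale: "integer_module I \<Longrightarrow> integer_module (c *o I)"
  unfolding integer_module_def elt_set_times_def
  by (auto simp: mult.left_commute simp flip: distrib_left)

lemma integer_module_plus:
  assumes "integer_module I" and "integer_module J"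
  shows "integer_module (I + J)"
  unfolding integer_module_def
proof (intro conjI ballI)
  show "0 \<in> I + J"
    using set_plus_intro[OF integer_module_0[OF assms(1)] integer_module_0[OF assms(2)]] by simp
next
  fix x y assume "x \<in> I + J" "y \<in> I + J"
  then obtain a b c d where "x = a + b" "y = c + d" "a \<in> I" "b \<in> J" "c \<in> I" "d \<in> J"
    by (auto elim!: set_plus_elim)
  moreover from this have "(a + c) + (b + d) \<in> I + J"
    using assms by (intro set_plus_intro integer_module_add)
  ultimately show "x + y \<in> I + J" by (simp add: add_ac)
next
  fix r x :: 'a assume "r \<in> ring_of_integers" "x \<in> I + J"
  then obtain a b where "x = a + b" "a \<in> I" "b \<in> J" by (auto elim!: set_plus_elim)
  with \<open>r \<in> ring_of_integers\<close> show "r * x \<in> I + J"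
    using assms by (simp add: distrib_left set_plus_intro integer_module_mult)
qed

lemma integer_module_plus_left:
  "integer_module J \<Longrightarrow> x \<in> I \<Longrightarrow> x \<in> I + J"
  using set_plus_intro[of x I 0 J] by (simp add: integer_module_0)

lemma integer_module_plus_right:
  "integer_module I \<Longrightarrow> x \<in> J \<Longrightarrow> x \<in> I + J"
  using set_plus_intro[of 0 I x J] by (simp add: integer_module_0)

lemma integer_module_inverse: "integer_module (ideal_inverse I)"
  unfolding integer_module_def ideal_inverse_def
  by (auto simp: distrib_right ring_of_integers_add mult.assoc ring_of_integers_mult)

section \<open>Inverses and products of ideals\<close>

lemma ideal_inverseD: "x \<in> ideal_inverse I \<Longrightarrow> a \<in> I \<Longrightarrow> x * a \<in> ring_of_integers"
  by (simp add: ideal_inverse_def)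

lemma ideal_mult_0: "0 \<in> I \<cdot>\<^sub>I J"
  unfolding ideal_mult_def by (rule CollectI, rule exI[of _ 0]) auto

lemma ideal_mult_add_product:
  assumes "z \<in> I \<cdot>\<^sub>I J" and "a \<in> I" and "b \<in> J"
  shows "z + a * b \<in> I \<cdot>\<^sub>I J"
proof -
  obtain m x y where z: "z = (\<Sum>l<(m::nat). x l * y l)" "\<forall>l<m. x l \<in> I \<and> y l \<in> J"
    using assms(1) by (auto simp: ideal_mult_def)
  have "z + a * b = (\<Sum>l<Suc m. (x(m := a)) l * (y(m := b)) l)" 
    by (simp add: z(1))
  moreover have "\<forall>l<Suc m. (x(m := a)) l \<in> I \<and> (y(m := b)) l \<in> J"
    using z(2) assms(2,3) by (auto simp: less_Suc_eq)
  ultimately show ?thesis unfolding ideal_mult_def by blast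
qed

lemma ideal_mult_memI: "a \<in> I \<Longrightarrow> b \<in> J \<Longrightarrow> a * b \<in> I \<cdot>\<^sub>I J"
  using ideal_mult_add_product[OF ideal_mult_0] by fastforce

text \<open>Elements of an ideal product are sums of unspecified length; this rule adds one product
  at a time and avoids all later index bookkeeping.\<close>

lemma ideal_mult_induct [consumes 1, case_names zero step]:
  assumes "z \<in> I \<cdot>\<^sub>I J" and "P 0"
    and step: "\<And>z a b. z \<in> I \<cdot>\<^sub>I J \<Longrightarrow> P z \<Longrightarrow> a \<in> I \<Longrightarrow> b \<in> J \<Longrightarrow> P (z + a * b)"
  shows "P z"
proof -
  obtain m x y where z: "z = (\<Sum>l<(m::nat). x l * y l)" "\<forall>l<m. x l \<in> I \<and> y l \<in> J"
    using assms(1) by (auto simp: ideal_mult_def)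
  have "(\<Sum>l<k. x l * y l) \<in> I \<cdot>\<^sub>I J \<and> P (\<Sum>l<k. x l * y l)" if "k \<le> m" for k
    using that
  proof (induction k)
    case (Suc k)
    then show ?case using z(2) step ideal_mult_add_product[where I = I and J = J] by (simp add: Suc_le_eq)
  qed (simp add: \<open>P 0\<close> ideal_mult_0)
  then show ?thesis using z(1) by blast
qed

lemma ideal_mult_subset:
  assumes "integer_module S" and "\<And>a b. a \<in> I \<Longrightarrow> b \<in> J \<Longrightarrow> a * b \<in> S"
  shows "I \<cdot>\<^sub>I J \<subseteq> S"
proof
  fix z assume "z \<in> I \<cdot>\<^sub>I J"
  then show "z \<in> S"
    by (induction rule: ideal_mult_induct) (simp_all add: assms integer_module_0 integer_module_add)
qed

lemma integer_module_ideal_mult: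
  assumes "integer_module J"
  shows "integer_module (I \<cdot>\<^sub>I J)"
  unfolding integer_module_def
proof (intro conjI ballI)
  fix x y assume x: "x \<in> I \<cdot>\<^sub>I J" and "y \<in> I \<cdot>\<^sub>I J"
  from this(2) show "x + y \<in> I \<cdot>\<^sub>I J"
    by (induction rule: ideal_mult_induct)
      (simp_all add: x ideal_mult_add_product flip: add.assoc)
next
  fix r x :: 'a assume r: "r \<in> ring_of_integers" and "x \<in> I \<cdot>\<^sub>I J"
  from this(2) show "r * x \<in> I \<cdot>\<^sub>I J"
  proof (induction rule: ideal_mult_induct)
    case (step z a b)
    have "r * (z + a * b) = r * z + a * (r * b)" by (simp add: algebra_simps)
    then show ?case using step r assms by (simp add: ideal_mult_add_product integer_module_mult)
  qed (simp add: ideal_mult_0)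
qed (rule ideal_mult_0)

text \<open>The inclusion of \<open>I J^-1 J\<close> in \<open>I\<close> follows from the definition
  of the inverse alone. It turns congruences modulo an ideal quotient into congruences modulo the
  numerator.\<close>

lemma ideal_mult_inverse_mult:
  assumes "integer_module I" and "z \<in> I \<cdot>\<^sub>I ideal_inverse J" and "a \<in> J"
  shows "z * a \<in> I"
  using assms(2)
proof (induction rule: ideal_mult_induct)
  case (step z x y)
  have "(z + x * y) * a = z * a + (y * a) * x" by (simp add: algebra_simps)
  then show ?case
    using step assms(3) by (simp add: assms(1) integer_module_add integer_module_mult ideal_inverseD)
qed (simp add: assms(1) integer_module_0)

lemma integer_module_foldr:
  "integer_module (foldr (\<lambda>i J. I i \<cdot>\<^sub>I J) xs ring_of_integers)"
  by (induction xs) (simp_all add: integer_module_ring_of_integers integer_module_ideal_mult)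

lemma integer_module_ideal_prod: "integer_module (ideal_prod n I)"
  by (simp add: ideal_prod_def integer_module_foldr)

lemma prod_lessThan_conv_prod_list: "(\<Prod>i<n. f i) = (\<Prod>i\<leftarrow>[0..<n]. f i)"
  using prod.distinct_set_conv_list[of "[0..<n]" f] by (simp add: atLeast0LessThan)

lemma prod_mem_ideal_prod:
  assumes "\<And>i. i < n \<Longrightarrow> x i \<in> I i"
  shows "(\<Prod>i<n. x i) \<in> ideal_prod n I"
proof -
  have "(\<Prod>i\<leftarrow>xs. x i) \<in> foldr (\<lambda>i J. I i \<cdot>\<^sub>I J) xs ring_of_integers"
    if "\<forall>i\<in>set xs. x i \<in> I i" for xs
    using that by (induction xs) (simp_all add: ideal_mult_memI)
  from this[of "[0..<n]"] show ?thesis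
    using assms by (simp add: ideal_prod_def prod_lessThan_conv_prod_list)
qed

text \<open>The universal property of the iterated product, by which statements about it are reduced
  to products with one factor from each ideal.\<close>

lemma ideal_prod_subset:
  assumes S: "integer_module S"
    and prods: "\<And>x. (\<And>i. i < n \<Longrightarrow> x i \<in> I i) \<Longrightarrow> (\<Prod>i<n. x i) \<in> S"
  shows "ideal_prod n I \<subseteq> S"
proof
  fix y assume y: "y \<in> ideal_prod n I"
  \<comment> \<open>The target \<open>S\<close> has to vary: after splitting off a first factor
    \<open>p\<close>, the induction continues with the module of all \<open>z\<close> such that
    \<open>p * z\<close> lies in \<open>S\<close>. Distinct indices allow \<open>p\<close> to be
    chosen independently of the other factors.\<close>
  have "y \<in> S" if "distinct xs" "y \<in> foldr (\<lambda>i J. I i \<cdot>\<^sub>I J) xs ring_of_integers" "integer_module S"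
    "\<And>x. (\<forall>i\<in>set xs. x i \<in> I i) \<Longrightarrow> (\<Prod>i\<leftarrow>xs. x i) \<in> S" for xs S y
    using that
  proof (induction xs arbitrary: S y)
    case Nil
    then show ?case using integer_module_mult_right[of S y 1] by simp
  next
    case (Cons a xs)
    have "I a \<cdot>\<^sub>I foldr (\<lambda>i J. I i \<cdot>\<^sub>I J) xs ring_of_integers \<subseteq> S"
    proof (rule ideal_mult_subset[OF Cons.prems(3)])
      fix p z assume p: "p \<in> I a" and z: "z \<in> foldr (\<lambda>i J. I i \<cdot>\<^sub>I J) xs ring_of_integers"
      have "z \<in> {z. p * z \<in> S}"
      proof (rule Cons.IH[OF _ z])
        show "integer_module {z. p * z \<in> S}"
          using Cons.prems(3) unfolding integer_module_def
          by (auto simp: distrib_left mult.left_commute[of p])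
        fix x assume x: "\<forall>i\<in>set xs. x i \<in> I i"
        have map: "map (x(a := p)) xs = map x xs" using Cons.prems(1) by auto
        have "(\<Prod>i\<leftarrow>a # xs. (x(a := p)) i) \<in> S"
          by (rule Cons.prems(4)) (use x p in auto)
        then show "(\<Prod>i\<leftarrow>xs. x i) \<in> {z. p * z \<in> S}"
          by (simp add: map del: fun_upd_apply) (simp add: fun_upd_same)
      qed (use Cons.prems(1) in simp)
      then show "p * z \<in> S" by simp
    qed
    then show ?case using Cons.prems(2) by auto
  qed
  from this[of "[0..<n]" y S] show "y \<in> S"
    using y S prods by (simp add: ideal_prod_def prod_lessThan_conv_prod_list)
qed

text \<open>
  Fractional ideals without finite generation: enough for denominators to be positive, and stable
  under products and inverses without any Noetherian argument.
\<close>

definition bounded_module :: "'k::field_char_0 set \<Rightarrow> bool" where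
  "bounded_module I \<longleftrightarrow> integer_module I \<and> (\<exists>x\<in>I. x \<noteq> 0) \<and>
     (\<exists>m::nat. 0 < m \<and> (\<forall>x\<in>I. of_nat m * x \<in> ring_of_integers))"

lemma bounded_moduleE:
  assumes "bounded_module I"
  obtains a and m :: nat where "integer_module I" "a \<in> I" "a \<noteq> 0" "0 < m"
    "\<And>x. x \<in> I \<Longrightarrow> of_nat m * x \<in> ring_of_integers"
  using assms by (auto simp: bounded_module_def)

text \<open>Each generator has a positive integer multiple that is integral; the product of these
  integers is a common denominator for the whole ideal.\<close>

lemma bounded_module_fractional_ideal:
  assumes K: "number_field TYPE('k::field_char_0)" and I: "fractional_ideal (I :: 'k set)"
  shows "bounded_module I"
proof -
  obtain S where S: "finite S" "I = {\<Sum>s\<in>S. c s * s | c. \<forall>s\<in>S. c s \<in> ring_of_integers}"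
    using I by (auto simp: fractional_ideal_def)
  have mod: "integer_module I"
    unfolding integer_module_def
  proof (intro conjI ballI)
    show "0 \<in> I" unfolding S(2) by (rule CollectI, rule exI[of _ "\<lambda>_. 0"]) simp
  next
    fix x y assume "x \<in> I" "y \<in> I"
    then obtain c d where "x = (\<Sum>s\<in>S. c s * s)" "y = (\<Sum>s\<in>S. d s * s)"
      "\<forall>s\<in>S. c s \<in> ring_of_integers" "\<forall>s\<in>S. d s \<in> ring_of_integers"
      unfolding S(2) by auto
    then show "x + y \<in> I" unfolding S(2)
      by (intro CollectI exI[of _ "\<lambda>s. c s + d s"])
        (simp add: sum.distrib distrib_right ring_of_integers_add)
  next
    fix r x :: 'k assume "r \<in> ring_of_integers" "x \<in> I"
    then obtain c where "x = (\<Sum>s\<in>S. c s * s)" "\<forall>s\<in>S. c s \<in> ring_of_integers"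
      unfolding S(2) by auto
    then show "r * x \<in> I" unfolding S(2)
      using \<open>r \<in> ring_of_integers\<close>
      by (intro CollectI exI[of _ "\<lambda>s. r * c s"])
        (simp add: sum_distrib_left mult.assoc ring_of_integers_mult)
  qed
  have "\<exists>m::'k \<Rightarrow> nat. \<forall>s. 0 < m s \<and> of_nat (m s) * s \<in> ring_of_integers"
    by (intro choice allI) (use number_field_algebraic_int_multiple[OF K] in blast)
  then obtain m :: "'k \<Rightarrow> nat" where m: "\<And>s. 0 < m s" "\<And>s. of_nat (m s) * s \<in> ring_of_integers"
    by blast
  define D where "D = prod m S"
  have "of_nat D * x \<in> ring_of_integers" if x: "x \<in> I" for x
  proof -
    obtain c where c: "x = (\<Sum>s\<in>S. c s * s)" "\<forall>s\<in>S. c s \<in> ring_of_integers"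
      using x unfolding S(2) by auto
    have "of_nat D * (c s * s) \<in> ring_of_integers" if s: "s \<in> S" for s
    proof -
      have "D = m s * prod m (S - {s})" by (simp only: D_def prod.remove[OF S(1) s])
      then have "of_nat D * (c s * s) = (of_nat (prod m (S - {s})) * c s) * (of_nat (m s) * s)"
        by (simp only: of_nat_mult mult_ac)
      then show ?thesis using c(2) s m(2) by (simp only: ring_of_integers_mult ring_of_integers_of_nat)
    qed
    then show ?thesis
      unfolding c(1) sum_distrib_left by (intro integer_module_sum integer_module_ring_of_integers)
  qed
  moreover have "0 < D" using m(1) S(1) by (simp add: D_def)
  moreover have "\<exists>x\<in>I. x \<noteq> 0"
    using I integer_module_0[OF mod] by (auto simp: fractional_ideal_def)
  ultimately show ?thesis using mod by (auto simp: bounded_module_def)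
qed

lemma bounded_module_scale:
  assumes K: "number_field TYPE('k::field_char_0)" and I: "bounded_module (I :: 'k set)" and "c \<noteq> 0"
  shows "bounded_module (c *o I)"
proof -
  obtain a and m :: nat where I: "integer_module I" "a \<in> I" "a \<noteq> 0" "0 < m"
    "\<And>x. x \<in> I \<Longrightarrow> of_nat m * x \<in> ring_of_integers"
    using I by (rule bounded_moduleE) blast
  obtain k :: nat where k: "0 < k" "of_nat k * c \<in> ring_of_integers"
    using number_field_algebraic_int_multiple[OF K] by blast
  have "of_nat (k * m) * x \<in> ring_of_integers" if x: "x \<in> c *o I" for x
  proof -
    obtain y where "y \<in> I" "x = c * y" using x by (auto simp: elt_set_times_def)
    moreover have "of_nat (k * m) * (c * y) = (of_nat k * c) * (of_nat m * y)" by simp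
    ultimately show ?thesis using k(2) I(5) by (simp only: ring_of_integers_mult)
  qed
  moreover have "c * a \<in> c *o I" "c * a \<noteq> 0" using I \<open>c \<noteq> 0\<close> by auto
  ultimately show ?thesis
    using I(1,4) k(1) integer_module_scale unfolding bounded_module_def
    by (intro conjI exI[of _ "k * m"] bexI[of _ "c * a"] ballI) auto
qed

text \<open>The bounds are stated separately from nonvanishing because a summand such as
  \<open>p *o I\<close> with \<open>p = 0\<close> is the zero module; only the sum has to contain a
  nonzero element.\<close>

lemma bounded_module_plus:
  assumes I: "integer_module I" "0 < (m::nat)" "\<And>x. x \<in> I \<Longrightarrow> of_nat m * x \<in> ring_of_integers"
    and J: "integer_module J" "0 < (k::nat)" "\<And>x. x \<in> J \<Longrightarrow> of_nat k * x \<in> ring_of_integers"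
    and nz: "a \<in> I + J" "a \<noteq> 0"
  shows "bounded_module (I + J)"
proof -
  have "of_nat (m * k) * x \<in> ring_of_integers" if x: "x \<in> I + J" for x
  proof -
    obtain y z where "y \<in> I" "z \<in> J" "x = y + z" using x by (auto elim: set_plus_elim)
    moreover have "of_nat (m * k) * (y + z) = of_nat k * (of_nat m * y) + of_nat m * (of_nat k * z)"
      by (simp add: algebra_simps)
    ultimately show ?thesis
      using I(3) J(3) by (simp only: ring_of_integers_add ring_of_integers_mult ring_of_integers_of_nat)
  qed
  moreover have "0 < m * k" using I(2) J(2) by simp
  ultimately show ?thesis
    unfolding bounded_module_def using nz integer_module_plus[OF I(1) J(1)] by blast
qed

text \<open>A fixed nonzero \<open>a\<close> in \<open>I\<close> bounds the inverse through
  \<open>x = inverse a * (x * a)\<close>, and a denominator of \<open>I\<close> is itself a nonzero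
  element of the inverse.\<close>

lemma bounded_module_inverse:
  assumes K: "number_field TYPE('k::field_char_0)" and I: "bounded_module (I :: 'k set)"
  shows "bounded_module (ideal_inverse I)"
proof -
  obtain a and m :: nat where I: "integer_module I" "a \<in> I" "a \<noteq> 0" "0 < m"
    "\<And>x. x \<in> I \<Longrightarrow> of_nat m * x \<in> ring_of_integers"
    using I by (rule bounded_moduleE) blast
  obtain k :: nat where k: "0 < k" "of_nat k * inverse a \<in> ring_of_integers"
    using number_field_algebraic_int_multiple[OF K] by blast
  have "of_nat k * x \<in> ring_of_integers" if "x \<in> ideal_inverse I" for x
  proof -
    have "of_nat k * x = (of_nat k * inverse a) * (x * a)" using I(3) by simp
    then show ?thesis using k(2) ideal_inverseD[OF that I(2)] by (simp only: ring_of_integers_mult)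
  qed
  moreover have "of_nat m \<in> ideal_inverse I" using I(5) by (simp add: ideal_inverse_def)
  moreover have "(of_nat m :: 'k) \<noteq> 0" using I(4) by simp
  ultimately show ?thesis
    using k(1) integer_module_inverse unfolding bounded_module_def by blast
qed

lemma bounded_module_mult:
  assumes I: "bounded_module I" and J: "bounded_module J"
  shows "bounded_module (I \<cdot>\<^sub>I J)"
proof -
  obtain a and m :: nat where I: "integer_module I" "a \<in> I" "a \<noteq> 0" "0 < m"
    "\<And>x. x \<in> I \<Longrightarrow> of_nat m * x \<in> ring_of_integers"
    using I by (rule bounded_moduleE) blast
  obtain b and k :: nat where J: "integer_module J" "b \<in> J" "b \<noteq> 0" "0 < k"
    "\<And>x. x \<in> J \<Longrightarrow> of_nat k * x \<in> ring_of_integers"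
    using J by (rule bounded_moduleE) blast
  have "of_nat (m * k) * z \<in> ring_of_integers" if "z \<in> I \<cdot>\<^sub>I J" for z
    using that
  proof (induction rule: ideal_mult_induct)
    case (step z x y)
    have "of_nat (m * k) * (z + x * y) = of_nat (m * k) * z + (of_nat m * x) * (of_nat k * y)"
      by (simp add: algebra_simps)
    then show ?case using step I(5) J(5) by (simp only: ring_of_integers_add ring_of_integers_mult)
  qed simp
  moreover have "a * b \<in> I \<cdot>\<^sub>I J" "a * b \<noteq> 0" "0 < m * k" using I J ideal_mult_memI by auto
  ultimately show ?thesis
    using integer_module_ideal_mult[OF J(1)] unfolding bounded_module_def by blast
qed

section \<open>Normalization of pairs and reduction of entries\<close>

lemma denominator_pos:
  assumes "bounded_module I"
  shows "0 < denominator I"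
proof -
  obtain m :: nat where "0 < m" "\<And>x. x \<in> I \<Longrightarrow> of_nat m * x \<in> ring_of_integers"
    using assms by (rule bounded_moduleE) blast
  then have "0 < m \<and> of_nat m *o I \<subseteq> ring_of_integers" by (auto simp: elt_set_times_def)
  from LeastI[of "\<lambda>k. 0 < k \<and> of_nat k *o I \<subseteq> ring_of_integers", OF this] show ?thesis
    unfolding denominator_def by simp
qed

text \<open>All four steps of normalization amount to multiplying the ideal by one nonzero scalar
  and dividing the row by it, so the product of ideal and row is unchanged.\<close>

lemma normalizes_scaling:
  assumes K: "number_field TYPE('k::field_char_0)" and I: "bounded_module (I :: 'k set)"
    and norm: "normalizes I v I' v'"
  obtains c where "c \<noteq> 0" "I' = c *o I" "v' = inverse c \<cdot>\<^sub>v v"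
proof -
  define k0 :: 'k where "k0 = of_nat (denominator I)"
  define k :: 'k where "k = of_nat (denominator (ideal_inverse (k0 *o I)))"
  obtain r where r: "LLL_reduced_basis r (k *o ideal_inverse (k0 *o I))"
    "I' = (r 0 / k) *o (k0 *o I)" "v' = (k / r 0) \<cdot>\<^sub>v (inverse k0 \<cdot>\<^sub>v v)"
    using norm unfolding normalizes_def Let_def k0_def k_def by blast
  have k0: "k0 \<noteq> 0" using denominator_pos[OF I] by (simp add: k0_def)
  then have k: "k \<noteq> 0"
    using denominator_pos[OF bounded_module_inverse[OF K bounded_module_scale[OF K I]]]
    by (simp add: k_def)
  have "r 0 \<noteq> 0"
  proof
    assume 0: "r 0 = 0"
    \<comment> \<open>If \<open>r 0\<close> vanished, the coefficient vector with a single 1 at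
      index 0 would be a nontrivial integral relation between the basis elements.\<close>
    have "(\<Sum>i<field_degree TYPE('k). of_int (if i = 0 then 1 else 0) * r i) = 0"
      using 0 by (intro sum.neutral) auto
    moreover have indep: "\<forall>c::nat \<Rightarrow> int. (\<Sum>i<field_degree TYPE('k). of_int (c i) * r i) = 0 \<longrightarrow>
        (\<forall>i<field_degree TYPE('k). c i = 0)"
      using r(1) unfolding LLL_reduced_basis_def Z_basis_def by (elim conjE)
    ultimately have "\<forall>i<field_degree TYPE('k). (if i = 0 then 1 else 0) = (0::int)"
      by (intro indep[THEN spec, THEN mp])
    then show False using number_field_degree_pos[OF K] by auto
  qed
  moreover have "I' = (r 0 / k * k0) *o I" by (simp add: r(2) set_times_rearrange2)
  moreover have "v' = inverse (r 0 / k * k0) \<cdot>\<^sub>v v"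
    by (simp add: r(3) smult_smult_assoc field_simps)
  ultimately show ?thesis using that[of "r 0 / k * k0"] k0 k by simp
qed

text \<open>Zero has norm 0 and the bound is nonnegative, so the early exit applies. Hence reduction
  never destroys an eliminated entry.\<close>

lemma reduces_0: "reduces I 0 b \<Longrightarrow> b = 0"
proof -
  have "\<sigma> 0 = 0" if "\<sigma> \<in> embeddings" for \<sigma> :: "'a \<Rightarrow> complex"
  proof -
    interpret field_hom \<sigma> using that by (simp add: embeddings_def)
    show ?thesis by (rule hom_zero)
  qed
  then have "(\<Sum>\<sigma>\<in>(embeddings :: ('a \<Rightarrow> complex) set). (cmod (\<sigma> 0))\<^sup>2) = 0"
    by (intro sum.neutral) simp
  moreover have "0 \<le> reduction_bound I"
    by (simp add: reduction_bound_def Let_def)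
  ultimately show "reduces I 0 b \<Longrightarrow> b = 0"
    by (simp add: reduces_def T2_norm_def)
qed

lemma reduces_1: "reduces I 1 b \<Longrightarrow> b = 1"
  by (simp add: reduces_def)

text \<open>Rounding subtracts an integral combination of a basis of \<open>I\<close>. Algorithms H
  and E use reduction only through this congruence and through the fixed points 0 and 1.\<close>

lemma reduces_diff:
  assumes "integer_module I" and "reduces I a b"
  shows "b - a \<in> I"
proof (cases "b = a")
  case False
  then obtain r and m :: "nat \<Rightarrow> int" where "LLL_reduced_basis r I"
    "b = a - (\<Sum>i<field_degree TYPE('a). of_int (m i) * r i)"
    using assms(2) by (auto simp: reduces_def split: if_splits)
  then have "(\<Sum>i<field_degree TYPE('a). of_int (m i) * r i) \<in> I"
    "b - a = - (\<Sum>i<field_degree TYPE('a). of_int (m i) * r i)"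
    by (auto simp: LLL_reduced_basis_def Z_basis_def)
  then show ?thesis using integer_module_uminus[OF assms(1)] by simp
qed (simp add: assms(1) integer_module_0)

section \<open>Row spans and Cramer's rule\<close>

text \<open>A counterpart of \<open>pseudo_span\<close> on functions: entries from index
  \<open>n\<close> on stay unconstrained, so vectors can be written as plain abstractions without
  truncation.\<close>

definition row_span :: "nat \<Rightarrow> (nat \<Rightarrow> 'k::field_char_0 set) \<Rightarrow> (nat \<Rightarrow> nat \<Rightarrow> 'k) \<Rightarrow> (nat \<Rightarrow> 'k) set" where
  "row_span n I a = {f. \<exists>x. (\<forall>i<n. x i \<in> I i) \<and> (\<forall>k<n. f k = (\<Sum>i<n. x i * a i k))}"

lemma row_spanI: "(\<And>i. i < n \<Longrightarrow> x i \<in> I i) \<Longrightarrow> (\<And>k. k < n \<Longrightarrow> f k = (\<Sum>i<n. x i * a i k)) \<Longrightarrow> f \<in> row_span n I a"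
  by (auto simp: row_span_def)

lemma row_spanE:
  assumes "f \<in> row_span n I a"
  obtains x where "\<And>i. i < n \<Longrightarrow> x i \<in> I i" "\<And>k. k < n \<Longrightarrow> f k = (\<Sum>i<n. x i * a i k)"
  using assms by (auto simp: row_span_def)

lemma pseudo_span_eq_row_span:
  "pseudo_span n I A = vec n ` row_span n I (\<lambda>i k. A $$ (i, k))"
  unfolding pseudo_span_def
proof (intro equalityI subsetI)
  fix v assume "v \<in> {vec n (\<lambda>k. \<Sum>i<n. x i * A $$ (i, k)) | x. \<forall>i<n. x i \<in> I i}"
  then show "v \<in> vec n ` row_span n I (\<lambda>i k. A $$ (i, k))"
    by (auto intro!: imageI row_spanI)
next
  fix v assume "v \<in> vec n ` row_span n I (\<lambda>i k. A $$ (i, k))"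
  then obtain f x where "v = vec n f" "\<And>i. i < n \<Longrightarrow> x i \<in> I i"
    "\<And>k. k < n \<Longrightarrow> f k = (\<Sum>i<n. x i * A $$ (i, k))"
    by (auto elim!: row_spanE)
  moreover from this have "vec n f = vec n (\<lambda>k. \<Sum>i<n. x i * A $$ (i, k))" by (intro eq_vecI) auto
  ultimately show "v \<in> {vec n (\<lambda>k. \<Sum>i<n. x i * A $$ (i, k)) | x. \<forall>i<n. x i \<in> I i}" by blast
qed

text \<open>Vectors are functions of which only the values at the indices below \<open>n\<close> matter.\<close>

definition vector_module :: "nat \<Rightarrow> (nat \<Rightarrow> 'k::field_char_0) set \<Rightarrow> bool" where
  "vector_module n S \<longleftrightarrow> (\<lambda>_. 0) \<in> S \<and> (\<forall>f\<in>S. \<forall>g\<in>S. (\<lambda>k. f k + g k) \<in> S) \<and>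
     (\<forall>r\<in>ring_of_integers. \<forall>f\<in>S. (\<lambda>k. r * f k) \<in> S) \<and>
     (\<forall>f\<in>S. \<forall>g. (\<forall>k<n. g k = f k) \<longrightarrow> g \<in> S)"

lemma vector_module_0: "vector_module n S \<Longrightarrow> (\<lambda>_. 0) \<in> S"
  and vector_module_add: "vector_module n S \<Longrightarrow> f \<in> S \<Longrightarrow> g \<in> S \<Longrightarrow> (\<lambda>k. f k + g k) \<in> S"
  and vector_module_mult: "vector_module n S \<Longrightarrow> r \<in> ring_of_integers \<Longrightarrow> f \<in> S \<Longrightarrow> (\<lambda>k. r * f k) \<in> S"
  and vector_module_cong: "vector_module n S \<Longrightarrow> f \<in> S \<Longrightarrow> (\<And>k. k < n \<Longrightarrow> g k = f k) \<Longrightarrow> g \<in> S"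
  unfolding vector_module_def by blast+

lemma vector_module_sum:
  assumes "vector_module n S" and "\<And>i. i \<in> A \<Longrightarrow> f i \<in> S"
  shows "(\<lambda>k. \<Sum>i\<in>A. f i k) \<in> S"
  using assms(2) by (induction A rule: infinite_finite_induct)
    (simp_all add: vector_module_0[OF assms(1)] vector_module_add[OF assms(1)])

lemma vector_module_diff:
  assumes "vector_module n S" and "f \<in> S" and "g \<in> S"
  shows "(\<lambda>k. f k - g k) \<in> S"
  using vector_module_add[OF assms(1,2) vector_module_mult[OF assms(1) ring_of_integers_neg_1 assms(3)]]
  by simp

lemma vector_module_row_span:
  assumes I: "\<And>i. i < n \<Longrightarrow> integer_module (I i)"
  shows "vector_module n (row_span n I a)"
  unfolding vector_module_def
proof (intro conjI ballI allI impI)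
  show "(\<lambda>_. 0) \<in> row_span n I a"
    by (rule row_spanI[where x = "\<lambda>_. 0"]) (simp_all add: I integer_module_0)
next
  fix f g assume "f \<in> row_span n I a" "g \<in> row_span n I a"
  then obtain x y where "\<And>i. i < n \<Longrightarrow> x i \<in> I i" "\<And>k. k < n \<Longrightarrow> f k = (\<Sum>i<n. x i * a i k)"
    "\<And>i. i < n \<Longrightarrow> y i \<in> I i" "\<And>k. k < n \<Longrightarrow> g k = (\<Sum>i<n. y i * a i k)"
    by (elim row_spanE) blast
  then show "(\<lambda>k. f k + g k) \<in> row_span n I a"
    by (intro row_spanI[where x = "\<lambda>i. x i + y i"])
      (simp_all add: I integer_module_add distrib_right sum.distrib)
next
  fix r :: 'a and f assume r: "r \<in> ring_of_integers" and "f \<in> row_span n I a"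
  then obtain x where "\<And>i. i < n \<Longrightarrow> x i \<in> I i" "\<And>k. k < n \<Longrightarrow> f k = (\<Sum>i<n. x i * a i k)"
    by (elim row_spanE) blast
  then show "(\<lambda>k. r * f k) \<in> row_span n I a"
    by (intro row_spanI[where x = "\<lambda>i. r * x i"])
      (simp_all add: I r integer_module_mult sum_distrib_left mult.assoc)
next
  fix f g assume "f \<in> row_span n I a" "\<forall>k<n. g k = f k"
  then show "g \<in> row_span n I a" by (simp add: row_span_def)
qed

lemma row_span_base:
  assumes I: "\<And>i. i < n \<Longrightarrow> integer_module (I i)" and "i < n" and "x \<in> I i"
  shows "(\<lambda>k. x * a i k) \<in> row_span n I a"
proof (rule row_spanI)
  fix j assume "j < n"
  then show "(if j = i then x else 0) \<in> I j" using assms by (simp add: integer_module_0)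
next
  fix k assume "k < n"
  then show "x * a i k = (\<Sum>j<n. (if j = i then x else 0) * a j k)"
    using \<open>i < n\<close> by (simp add: if_distrib[of "\<lambda>z. z * _"] cong: if_cong)
qed

lemma row_span_subset:
  assumes S: "vector_module n S" and base: "\<And>i x. i < n \<Longrightarrow> x \<in> I i \<Longrightarrow> (\<lambda>k. x * a i k) \<in> S"
  shows "row_span n I a \<subseteq> S"
proof
  fix f assume "f \<in> row_span n I a"
  then obtain x where x: "\<And>i. i < n \<Longrightarrow> x i \<in> I i" "\<And>k. k < n \<Longrightarrow> f k = (\<Sum>i<n. x i * a i k)"
    by (elim row_spanE) blast
  have "(\<lambda>k. \<Sum>i<n. x i * a i k) \<in> S"
    by (rule vector_module_sum[OF S]) (simp add: base x(1))
  then show "f \<in> S" by (rule vector_module_cong[OF S]) (rule x(2))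
qed

section \<open>Determinants and determinantal ideals\<close>

definition fdet :: "nat \<Rightarrow> (nat \<Rightarrow> nat \<Rightarrow> 'k::field_char_0) \<Rightarrow> 'k" where
  "fdet n a = det (mat n n (\<lambda>(i, k). a i k))"

lemma fdet_eq_sum:
  "fdet n a = (\<Sum>p | p permutes {..<n}. signof p * (\<Prod>i<n. a i (p i)))"
proof -
  have "(\<Prod>i<n. mat n n (\<lambda>(i, k). a i k) $$ (i, p i)) = (\<Prod>i<n. a i (p i))"
    if "p permutes {..<n}" for p
    using permutes_in_image[OF that] by (intro prod.cong) auto
  then show ?thesis
    by (simp add: fdet_def det_def'[of _ n] atLeast0LessThan)
qed

lemma fdet_scale_rows: "fdet n (\<lambda>i k. x i * a i k) = (\<Prod>i<n. x i) * fdet n a"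
  by (simp add: fdet_eq_sum prod.distrib sum_distrib_left mult.left_commute)

lemma fdet_mult: "fdet n (\<lambda>i k. \<Sum>s<n. y i s * a s k) = fdet n y * fdet n a"
proof -
  have "mat n n (\<lambda>(i, k). \<Sum>s<n. y i s * a s k) = mat n n (\<lambda>(i, k). y i k) * mat n n (\<lambda>(i, k). a i k)"
    by (rule eq_matI) (simp_all add: scalar_prod_def atLeast0LessThan)
  then show ?thesis by (simp add: fdet_def det_mult[of _ n])
qed

lemma fdet_cong: "(\<And>i k. i < n \<Longrightarrow> k < n \<Longrightarrow> a i k = b i k) \<Longrightarrow> fdet n a = fdet n b"
  unfolding fdet_def by (intro arg_cong[of _ _ det] eq_matI) auto

text \<open>Every Leibniz term takes exactly one factor from each column and so lies in the product
  of the column ideals.\<close>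

lemma fdet_mem_ideal_prod:
  assumes "\<And>i s. i < n \<Longrightarrow> s < n \<Longrightarrow> y i s \<in> I s"
  shows "fdet n y \<in> ideal_prod n I"
  unfolding fdet_eq_sum
proof (rule integer_module_sum[OF integer_module_ideal_prod])
  fix p assume "p \<in> {p. p permutes {..<n}}"
  then have p: "p permutes {..<n}" by simp
  \<comment> \<open>Reindexing by the inverse permutation orders the factors by column.\<close>
  have "(\<Prod>s<n. y (inv_into UNIV p s) s) = (\<Prod>i<n. y i (p i))"
    using prod.permute[OF p, of "\<lambda>s. y (inv_into UNIV p s) s"] permutes_inverses(2)[OF p] by (simp add: o_def)
  moreover have "(\<Prod>s<n. y (inv_into UNIV p s) s) \<in> ideal_prod n I"
    by (intro prod_mem_ideal_prod assms) (use permutes_in_image[OF permutes_inv[OF p]] in auto)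
  moreover have "(signof p :: 'a) \<in> ring_of_integers"
    by (simp add: sign_def ring_of_integers_neg_1)
  ultimately show "signof p * (\<Prod>i<n. y i (p i)) \<in> ideal_prod n I"
    by (simp only: integer_module_mult[OF integer_module_ideal_prod])
qed

text \<open>
  Cramer's rule. The cofactors, times \<open>t\<close>, appear as determinants of matrices whose column \<open>s\<close> has
  entries in the \<open>s\<close>-th ideal when \<open>t\<close> lies in the \<open>l\<close>-th one.
\<close>

lemma fdet_mult_row:
  assumes l: "l < n"
  shows "t * fdet n y * a l k =
    (\<Sum>i<n. fdet n (y(i := (\<lambda>s. if s = l then t else 0))) * (\<Sum>s<n. y i s * a s k))"
proof -
  define Y where "Y = mat n n (\<lambda>(i, k). y i k)"
  have Y: "Y \<in> carrier_mat n n" by (simp add: Y_def)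
  \<comment> \<open>Laplace expansion along row \<open>i\<close>, whose only nonzero entry is
    \<open>t\<close>; the replaced row does not occur in its own cofactors.\<close>
  have cof: "fdet n (y(i := (\<lambda>s. if s = l then t else 0))) = t * cofactor Y i l" if i: "i < n" for i
  proof -
    define Z where "Z = mat n n (\<lambda>(i', k). (y(i := (\<lambda>s. if s = l then t else 0))) i' k)"
    have Z: "Z \<in> carrier_mat n n" by (simp add: Z_def)
    have "mat_delete Z i l = mat_delete Y i l"
      by (rule eq_matI) (auto simp: mat_delete_def Z_def Y_def)
    then have "cofactor Z i s = cofactor Y i s" if "s = l" for s using that by (simp add: cofactor_def)
    moreover have "det Z = (\<Sum>s<n. Z $$ (i, s) * cofactor Z i s)"
      by (rule laplace_expansion_row[OF Z i])
    moreover have "\<dots> = (\<Sum>s<n. if s = l then t * cofactor Z i s else 0)"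
      using i by (intro sum.cong) (auto simp: Z_def)
    ultimately show ?thesis using l by (simp add: fdet_def Z_def)
  qed
  \<comment> \<open>This is the entry at \<open>(l, s)\<close> of the identity
    \<open>adj_mat Y * Y = det Y * 1\<close>.\<close>
  have adj: "(\<Sum>i<n. cofactor Y i l * y i s) = (if s = l then det Y else 0)" if s: "s < n" for s
  proof -
    have "(adj_mat Y * Y) $$ (l, s) = (det Y \<cdot>\<^sub>m 1\<^sub>m n) $$ (l, s)"
      by (simp add: adj_mat(3)[OF Y])
    then show ?thesis
      using l s Y by (auto simp: adj_mat_def scalar_prod_def atLeast0LessThan Y_def)
  qed
  have "(\<Sum>i<n. fdet n (y(i := (\<lambda>s. if s = l then t else 0))) * (\<Sum>s<n. y i s * a s k)) =
      (\<Sum>i<n. \<Sum>s<n. t * (cofactor Y i l * y i s) * a s k)"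
    by (simp add: cof sum_distrib_left mult_ac)
  also have "\<dots> = (\<Sum>s<n. t * (\<Sum>i<n. cofactor Y i l * y i s) * a s k)"
    by (subst sum.swap) (simp add: sum_distrib_left sum_distrib_right)
  also have "\<dots> = (\<Sum>s<n. if s = l then t * det Y * a s k else 0)"
    by (intro sum.cong) (auto simp: adj)
  also have "\<dots> = t * fdet n y * a l k" using l by (simp add: fdet_def Y_def)
  finally show ?thesis by simp
qed

text \<open>Coordinates of the scaled rows \<open>x i * b i\<close> in terms of the rows of
  \<open>a\<close> form a matrix \<open>y\<close>, and the determinant is multiplicative.\<close>

lemma row_span_matrix:
  assumes sub: "\<And>i z. i < n \<Longrightarrow> z \<in> J i \<Longrightarrow> (\<lambda>k. z * b i k) \<in> row_span n I a"
    and x: "\<And>i. i < n \<Longrightarrow> x i \<in> J i"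
  obtains y where "\<And>i s. i < n \<Longrightarrow> s < n \<Longrightarrow> y i s \<in> I s"
    "\<And>i k. i < n \<Longrightarrow> k < n \<Longrightarrow> x i * b i k = (\<Sum>s<n. y i s * a s k)"
    "(\<Prod>i<n. x i) * fdet n b = fdet n y * fdet n a"
proof -
  have "\<forall>i\<in>{..<n}. \<exists>y. (\<forall>s<n. y s \<in> I s) \<and> (\<forall>k<n. x i * b i k = (\<Sum>s<n. y s * a s k))"
    using sub[OF _ x] by (auto simp: row_span_def)
  from bchoice[OF this] obtain y
    where y: "\<forall>i\<in>{..<n}. (\<forall>s<n. y i s \<in> I s) \<and> (\<forall>k<n. x i * b i k = (\<Sum>s<n. y i s * a s k))" ..
  have "fdet n (\<lambda>i k. x i * b i k) = fdet n (\<lambda>i k. \<Sum>s<n. y i s * a s k)"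
    by (rule fdet_cong) (simp add: y)
  then show ?thesis using that[of y] y by (simp add: fdet_scale_rows fdet_mult)
qed

text \<open>On generators, this says that the determinantal ideal of a submodule is contained in
  that of the module.\<close>

lemma prod_fdet_mem:
  assumes sub: "\<And>i z. i < n \<Longrightarrow> z \<in> J i \<Longrightarrow> (\<lambda>k. z * b i k) \<in> row_span n I a"
    and x: "\<And>i. i < n \<Longrightarrow> x i \<in> J i"
  shows "(\<Prod>i<n. x i) * fdet n b \<in> fdet n a *o ideal_prod n I"
proof -
  obtain y where y: "\<And>i s. i < n \<Longrightarrow> s < n \<Longrightarrow> y i s \<in> I s"
    "\<And>i k. i < n \<Longrightarrow> k < n \<Longrightarrow> x i * b i k = (\<Sum>s<n. y i s * a s k)"
    and eq: "(\<Prod>i<n. x i) * fdet n b = fdet n y * fdet n a"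
    using row_span_matrix[where J = J and b = b and x = x, OF sub x] by blast
  from y(1) have "fdet n y \<in> ideal_prod n I" by (rule fdet_mem_ideal_prod)
  then show ?thesis unfolding eq by (simp add: mult.commute set_times_intro2)
qed

text \<open>Ideal form of Cramer's rule: the determinantal ideal of a submodule, divided by that of
  the ambient module, multiplies the ambient module into the submodule. The ambient rows have
  determinant 1, so its determinantal ideal is just the product of the \<open>I i\<close>.\<close>

lemma fdet_mult_row_mem_row_span:
  assumes J: "\<And>i. i < n \<Longrightarrow> integer_module (J i)"
    and I: "\<And>i. i < n \<Longrightarrow> integer_module (I i)"
    and sub: "\<And>i z. i < n \<Longrightarrow> z \<in> J i \<Longrightarrow> (\<lambda>k. z * b i k) \<in> row_span n I a"
    and det: "fdet n a = 1"
    and w: "w \<in> ideal_inverse (ideal_prod n I)"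
    and g: "g \<in> fdet n b *o ideal_prod n J"
    and l: "l < n" and t: "t \<in> I l"
  shows "(\<lambda>k. w * g * t * a l k) \<in> row_span n J b"
proof -
  let ?S = "{z. (\<lambda>k. w * (fdet n b * z) * t * a l k) \<in> row_span n J b}"
  have V: "vector_module n (row_span n J b)" by (rule vector_module_row_span[OF J])
  have "ideal_prod n J \<subseteq> ?S"
  proof (rule ideal_prod_subset)
    show "integer_module ?S"
      unfolding integer_module_def
    proof (intro conjI ballI)
      show "0 \<in> ?S" using vector_module_0[OF V] by simp
    next
      fix z z' assume "z \<in> ?S" "z' \<in> ?S"
      then have "(\<lambda>k. w * (fdet n b * z) * t * a l k + w * (fdet n b * z') * t * a l k) \<in> row_span n J b"
        by (intro vector_module_add[OF V]) simp_all
      then show "z + z' \<in> ?S" by (simp add: distrib_left distrib_right)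
    next
      fix r z :: 'a assume "r \<in> ring_of_integers" "z \<in> ?S"
      then have "(\<lambda>k. r * (w * (fdet n b * z) * t * a l k)) \<in> row_span n J b"
        using vector_module_mult[OF V] by blast
      then show "r * z \<in> ?S" by (simp add: mult_ac)
    qed
  next
    fix x assume x: "\<And>i. i < n \<Longrightarrow> x i \<in> J i"
    obtain y where y: "\<And>i s. i < n \<Longrightarrow> s < n \<Longrightarrow> y i s \<in> I s"
      "\<And>i k. i < n \<Longrightarrow> k < n \<Longrightarrow> x i * b i k = (\<Sum>s<n. y i s * a s k)"
      and eq: "(\<Prod>i<n. x i) * fdet n b = fdet n y * fdet n a"
      using row_span_matrix[where J = J and b = b and x = x, OF sub x] by blast
    \<comment> \<open>These are the coefficients, multiples of cofactors by \<open>t\<close>, that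
      express \<open>t * fdet n y * a l\<close> through the rows \<open>x i * b i\<close>. The
      modified matrix still has its column \<open>s\<close> in \<open>I s\<close>, so
      \<open>w\<close> makes each of them integral.\<close>
    define z where "z i = fdet n (y(i := (\<lambda>s. if s = l then t else 0)))" for i
    have z: "w * z i \<in> ring_of_integers" for i
      unfolding z_def
      by (intro ideal_inverseD[OF w] fdet_mem_ideal_prod) (auto simp: y t I integer_module_0)
    have "(\<lambda>k. w * (fdet n b * (\<Prod>i<n. x i)) * t * a l k) \<in> row_span n J b"
    proof (rule row_spanI[where x = "\<lambda>i. w * z i * x i"])
      fix i assume "i < n"
      then show "w * z i * x i \<in> J i" using z x J by (simp add: integer_module_mult)
    next
      fix k assume k: "k < n"
      have "w * (fdet n b * (\<Prod>i<n. x i)) * t * a l k = w * (t * fdet n y * a l k)"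
        using eq det by (simp add: mult_ac)
      also have "\<dots> = w * (\<Sum>i<n. z i * (x i * b i k))"
        unfolding fdet_mult_row[OF l, of t y a k] z_def using y(2) k by simp
      finally show "w * (fdet n b * (\<Prod>i<n. x i)) * t * a l k = (\<Sum>i<n. w * z i * x i * b i k)"
        by (simp add: sum_distrib_left mult.assoc)
    qed
    then show "(\<Prod>i<n. x i) \<in> ?S" by simp
  qed
  then show ?thesis using g by (auto simp: elt_set_times_def)
qed

section \<open>Algorithm H\<close>

text \<open>The sum of the modules \<open>I i * B_i\<close> and of \<open>\<gg> O^n\<close>, with
  the second summand written as an entrywise congruence.\<close>

definition span_mod :: "nat \<Rightarrow> 'k::field_char_0 set \<Rightarrow> (nat \<Rightarrow> 'k set) \<Rightarrow> 'k mat \<Rightarrow> (nat \<Rightarrow> 'k) set" where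
  "span_mod n \<gg> I B =
     {f. \<exists>h\<in>row_span n I (\<lambda>i k. B $$ (i, k)). \<forall>k<n. f k - h k \<in> \<gg>}"

lemma span_modI:
  "h \<in> row_span n I (\<lambda>i k. B $$ (i, k)) \<Longrightarrow> (\<And>k. k < n \<Longrightarrow> f k - h k \<in> \<gg>) \<Longrightarrow> f \<in> span_mod n \<gg> I B"
  by (auto simp: span_mod_def)

lemma vector_module_span_mod:
  assumes g: "integer_module \<gg>" and I: "\<And>i. i < n \<Longrightarrow> integer_module (I i)"
  shows "vector_module n (span_mod n \<gg> I B)"
proof -
  let ?R = "row_span n I (\<lambda>i k. B $$ (i, k))"
  have V: "vector_module n ?R" by (rule vector_module_row_span[OF I])
  show ?thesis
    unfolding vector_module_def
  proof (intro conjI ballI allI impI)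
    show "(\<lambda>_. 0) \<in> span_mod n \<gg> I B"
      by (rule span_modI[OF vector_module_0[OF V]]) (simp add: integer_module_0[OF g])
  next
    fix f f' assume "f \<in> span_mod n \<gg> I B" "f' \<in> span_mod n \<gg> I B"
    then obtain h h' where h: "h \<in> ?R" "\<forall>k<n. f k - h k \<in> \<gg>" "h' \<in> ?R" "\<forall>k<n. f' k - h' k \<in> \<gg>"
      by (auto simp: span_mod_def)
    have "f k + f' k - (h k + h' k) \<in> \<gg>" if "k < n" for k
      using integer_module_add[OF g, of "f k - h k" "f' k - h' k"] h that by (simp add: algebra_simps)
    then show "(\<lambda>k. f k + f' k) \<in> span_mod n \<gg> I B"
      by (rule span_modI[OF vector_module_add[OF V h(1,3)]])
  next
    fix r :: 'a and f assume r: "r \<in> ring_of_integers" and "f \<in> span_mod n \<gg> I B"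
    then obtain h where h: "h \<in> ?R" "\<forall>k<n. f k - h k \<in> \<gg>"
      by (auto simp: span_mod_def)
    have "r * f k - r * h k \<in> \<gg>" if "k < n" for k
      using integer_module_mult[OF g r, of "f k - h k"] h that by (simp add: right_diff_distrib)
    then show "(\<lambda>k. r * f k) \<in> span_mod n \<gg> I B"
      by (rule span_modI[OF vector_module_mult[OF V r h(1)]])
  qed (auto simp: span_mod_def)
qed

lemma span_mod_base:
  assumes g: "integer_module \<gg>" and I: "\<And>i. i < n \<Longrightarrow> integer_module (I i)"
    and "i < n" "x \<in> I i" and f: "\<And>k. k < n \<Longrightarrow> f k - x * B $$ (i, k) \<in> \<gg>"
  shows "f \<in> span_mod n \<gg> I B"
  by (rule span_modI[OF row_span_base[where I = I and a = "\<lambda>i k. B $$ (i, k)", OF I \<open>i < n\<close> \<open>x \<in> I i\<close>] f])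

lemma span_mod_modulus:
  assumes I: "\<And>i. i < n \<Longrightarrow> integer_module (I i)" and f: "\<And>k. k < n \<Longrightarrow> f k \<in> \<gg>"
  shows "f \<in> span_mod n \<gg> I B"
proof -
  have "(\<lambda>_. 0) \<in> row_span n I (\<lambda>i k. B $$ (i, k))"
    by (rule vector_module_0[OF vector_module_row_span[OF I]])
  then show ?thesis by (rule span_modI) (simp add: f)
qed

lemma span_mod_subset:
  assumes S: "vector_module n S"
    and base: "\<And>i x. i < n \<Longrightarrow> x \<in> I i \<Longrightarrow> (\<lambda>k. x * B $$ (i, k)) \<in> S"
    and g: "\<And>f. (\<And>k. k < n \<Longrightarrow> f k \<in> \<gg>) \<Longrightarrow> f \<in> S"
  shows "span_mod n \<gg> I B \<subseteq> S"
proof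
  fix f assume "f \<in> span_mod n \<gg> I B"
  then obtain h where h: "h \<in> row_span n I (\<lambda>i k. B $$ (i, k))" "\<forall>k<n. f k - h k \<in> \<gg>"
    by (auto simp: span_mod_def)
  have "row_span n I (\<lambda>i k. B $$ (i, k)) \<subseteq> S" by (rule row_span_subset[OF S base])
  then have "h \<in> S" using h(1) by blast
  moreover have "(\<lambda>k. f k - h k) \<in> S" using h(2) by (intro g) simp
  ultimately have "(\<lambda>k. h k + (f k - h k)) \<in> S" by (rule vector_module_add[OF S])
  then show "f \<in> S" by simp
qed

lemma bounded_module_integer_module: "bounded_module I \<Longrightarrow> integer_module I"
  by (simp add: bounded_module_def)

lemma scale_bounded:
  assumes K: "number_field TYPE('k::field_char_0)" and I: "bounded_module (I :: 'k set)"
  shows "\<exists>m::nat. 0 < m \<and> (\<forall>x\<in>c *o I. of_nat m * x \<in> ring_of_integers)"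
proof (cases "c = 0")
  case True
  then show ?thesis by (intro exI[of _ 1]) (auto simp: elt_set_times_def)
next
  case False
  then show ?thesis using bounded_module_scale[OF K I False] by (simp add: bounded_module_def)
qed

text \<open>Applied to the ideal \<open>\<dd>\<close> of an elimination step, where one of the two
  entries \<open>p\<close>, \<open>q\<close> may be zero.\<close>

lemma bounded_module_lincomb:
  assumes K: "number_field TYPE('k::field_char_0)"
    and I: "bounded_module (I :: 'k set)" and J: "bounded_module J" and pq: "p \<noteq> 0 \<or> q \<noteq> 0"
  shows "bounded_module (p *o I + q *o J)"
proof -
  obtain m k :: nat where mk: "0 < m" "\<forall>x\<in>p *o I. of_nat m * x \<in> ring_of_integers"
    "0 < k" "\<forall>x\<in>q *o J. of_nat k * x \<in> ring_of_integers"
    using scale_bounded[OF K I] scale_bounded[OF K J] by meson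
  obtain a b where ab: "a \<in> I" "a \<noteq> 0" "b \<in> J" "b \<noteq> 0"
    using I J by (auto simp: bounded_module_def)
  have mod: "integer_module (p *o I)" "integer_module (q *o J)"
    using I J by (simp_all add: bounded_module_integer_module integer_module_scale)
  have "\<exists>z\<in>p *o I + q *o J. z \<noteq> 0"
  proof (cases "p = 0")
    case False
    then show ?thesis
      using ab integer_module_plus_left[OF mod(2), of "p * a"] by (intro bexI[of _ "p * a"]) auto
  next
    case True
    then show ?thesis
      using pq ab integer_module_plus_right[OF mod(1), of "q * b"] by (intro bexI[of _ "q * b"]) auto
  qed
  then show ?thesis using bounded_module_plus[OF mod(1) mk(1) _ mod(2) mk(3)] mk(2,4) by blast
qed

text \<open>Replaces normalization by a scalar \<open>c\<close> and row operations by formulas for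
  entries. The Bezout relation excludes \<open>p = q = 0\<close>, so \<open>\<dd>\<close> is nonzero
  and all ideals stay bounded.\<close>

lemma hnf_stepE:
  assumes K: "number_field TYPE('k::field_char_0)"
    and step: "hnf_step n \<gg> (j, i) (B, \<bb>) (B', \<bb>' :: nat \<Rightarrow> 'k set)"
    and ij: "i < n" "j < n"
    and B: "B \<in> carrier_mat n n" and b: "bounded_module (\<bb> i)" "bounded_module (\<bb> j)"
  obtains p q \<dd> u v c where "p = B $$ (i, j)" "q = B $$ (j, j)" "\<dd> = p *o \<bb> i + q *o \<bb> j"
    "bounded_module \<dd>"
    "u \<in> \<bb> i \<cdot>\<^sub>I ideal_inverse \<dd>" "v \<in> \<bb> j \<cdot>\<^sub>I ideal_inverse \<dd>" "p * u + q * v = 1" "c \<noteq> 0"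
    "\<bb>' i = c *o (\<bb> i \<cdot>\<^sub>I \<bb> j \<cdot>\<^sub>I ideal_inverse \<dd>)" "bounded_module (\<bb>' i)" "\<bb>' j = \<dd>"
    "\<forall>l. l \<noteq> i \<and> l \<noteq> j \<longrightarrow> \<bb>' l = \<bb> l" "B' \<in> carrier_mat n n"
    "\<forall>k<n. reduces (\<gg> \<cdot>\<^sub>I ideal_inverse (\<bb>' i)) (inverse c * (q * B $$ (i, k) - p * B $$ (j, k))) (B' $$ (i, k))"
    "\<forall>k<n. reduces (\<gg> \<cdot>\<^sub>I ideal_inverse \<dd>) (u * B $$ (i, k) + v * B $$ (j, k)) (B' $$ (j, k))"
    "\<forall>l<n. \<forall>k<n. l \<noteq> i \<and> l \<noteq> j \<longrightarrow> B' $$ (l, k) = B $$ (l, k)"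
proof -
  define p q \<dd> where "p = B $$ (i, j)" "q = B $$ (j, j)" "\<dd> = p *o \<bb> i + q *o \<bb> j"
  obtain u v R where uv: "u \<in> \<bb> i \<cdot>\<^sub>I ideal_inverse \<dd>" "v \<in> \<bb> j \<cdot>\<^sub>I ideal_inverse \<dd>" "p * u + q * v = 1"
    and R: "normalizes (\<bb> i \<cdot>\<^sub>I \<bb> j \<cdot>\<^sub>I ideal_inverse \<dd>) (q \<cdot>\<^sub>v row B i - p \<cdot>\<^sub>v row B j) (\<bb>' i) R"
    and b': "\<bb>' j = \<dd>" "\<forall>l. l \<noteq> i \<and> l \<noteq> j \<longrightarrow> \<bb>' l = \<bb> l" and B': "B' \<in> carrier_mat n n"
    and red: "reduces_vec (\<gg> \<cdot>\<^sub>I ideal_inverse (\<bb>' i)) R (row B' i)"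
      "reduces_vec (\<gg> \<cdot>\<^sub>I ideal_inverse (\<bb>' j)) (u \<cdot>\<^sub>v row B i + v \<cdot>\<^sub>v row B j) (row B' j)"
    and rows: "\<forall>l<n. l \<noteq> i \<and> l \<noteq> j \<longrightarrow> row B' l = row B l"
    using step unfolding hnf_step_def Let_def prod.case p_q_\<dd>_def by blast
  have "p \<noteq> 0 \<or> q \<noteq> 0" using uv(3) by auto
  then have d: "bounded_module \<dd>"
    unfolding p_q_\<dd>_def(3) by (rule bounded_module_lincomb[OF K b])
  have bbd: "bounded_module (\<bb> i \<cdot>\<^sub>I \<bb> j \<cdot>\<^sub>I ideal_inverse \<dd>)"
    by (intro bounded_module_mult bounded_module_inverse K b d)
  obtain c where c: "c \<noteq> 0" "\<bb>' i = c *o (\<bb> i \<cdot>\<^sub>I \<bb> j \<cdot>\<^sub>I ideal_inverse \<dd>)"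
    "R = inverse c \<cdot>\<^sub>v (q \<cdot>\<^sub>v row B i - p \<cdot>\<^sub>v row B j)"
    by (rule normalizes_scaling[OF K bbd R])
  have r1: "reduces (\<gg> \<cdot>\<^sub>I ideal_inverse (\<bb>' i)) (inverse c * (q * B $$ (i, k) - p * B $$ (j, k))) (B' $$ (i, k))"
    if "k < n" for k
    using red(1) that ij B B' by (simp add: reduces_vec_def c(3))
  have r2: "reduces (\<gg> \<cdot>\<^sub>I ideal_inverse \<dd>) (u * B $$ (i, k) + v * B $$ (j, k)) (B' $$ (j, k))"
    if "k < n" for k
    using red(2) that ij B B' by (simp add: reduces_vec_def b'(1))
  have r3: "B' $$ (l, k) = B $$ (l, k)" if "l < n" "l \<noteq> i" "l \<noteq> j" "k < n" for l k
  proof -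
    have "row B' l $ k = row B l $ k" using rows that by simp
    then show ?thesis using that B B' by simp
  qed
  show ?thesis
    by (rule that[OF p_q_\<dd>_def d uv c(1,2) _ b' B'])
      (use bounded_module_scale[OF K bbd c(1)] c(2) r1 r2 r3 in auto)
qed

text \<open>On products of generators, \<open>a * b * w * q\<close> regroups as
  \<open>(w * (q * b)) * a\<close> with integral first factor.\<close>

lemma mult_inverse_mem:
  assumes I: "integer_module I" and z: "z \<in> I \<cdot>\<^sub>I J \<cdot>\<^sub>I ideal_inverse D"
    and q: "\<And>b. b \<in> J \<Longrightarrow> q * b \<in> D"
  shows "z * q \<in> I"
proof -
  have mod: "integer_module {z. z * r \<in> I}" for r
    using I unfolding integer_module_def by (auto simp: distrib_right mult.assoc)
  have "I \<cdot>\<^sub>I J \<cdot>\<^sub>I ideal_inverse D \<subseteq> {z. z * q \<in> I}"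
  proof (rule ideal_mult_subset[OF mod])
    fix y w assume "y \<in> I \<cdot>\<^sub>I J" and w: "w \<in> ideal_inverse D"
    have "I \<cdot>\<^sub>I J \<subseteq> {z. z * (w * q) \<in> I}"
    proof (rule ideal_mult_subset[OF mod])
      fix a b assume ab: "a \<in> I" "b \<in> J"
      have "(w * (q * b)) * a \<in> I"
        by (rule integer_module_mult[OF I ideal_inverseD[OF w q[OF ab(2)]] ab(1)])
      then show "a * b \<in> {z. z * (w * q) \<in> I}" by (simp add: mult_ac)
    qed
    then show "y * w \<in> {z. z * q \<in> I}" using \<open>y \<in> I \<cdot>\<^sub>I J\<close> by (auto simp: mult.assoc)
  qed
  then show ?thesis using z by blast
qed

lemma ideal_mult_commute: "I \<cdot>\<^sub>I J = J \<cdot>\<^sub>I I"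
proof -
  have "I \<cdot>\<^sub>I J \<subseteq> J \<cdot>\<^sub>I I" for I J :: "'a set"
  proof
    fix z assume "z \<in> I \<cdot>\<^sub>I J"
    then show "z \<in> J \<cdot>\<^sub>I I"
    proof (induction rule: ideal_mult_induct)
      case (step z a b)
      then show ?case using ideal_mult_add_product[of z J I b a] by (simp add: mult.commute)
    qed (rule ideal_mult_0)
  qed
  then show ?thesis by blast
qed

lemma mult_mem_mult_inverse:
  assumes "x \<in> I" and v: "v \<in> J \<cdot>\<^sub>I ideal_inverse D"
  shows "x * v \<in> I \<cdot>\<^sub>I J \<cdot>\<^sub>I ideal_inverse D"
  using v
proof (induction rule: ideal_mult_induct)
  case (step z a b)
  have "x * (z + a * b) = x * z + x * a * b" by (simp add: algebra_simps)
  then show ?case using step assms(1) by (simp add: ideal_mult_add_product ideal_mult_memI)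
qed (simp add: ideal_mult_0)

text \<open>Boundedness is carried along because the next normalization needs positive
  denominators.\<close>

definition hnf_invariant :: "nat \<Rightarrow> 'k::field_char_0 set \<Rightarrow> (nat \<Rightarrow> 'k) set \<Rightarrow> 'k mat \<Rightarrow> (nat \<Rightarrow> 'k set) \<Rightarrow> bool" where
  "hnf_invariant n \<gg> M B \<bb> \<longleftrightarrow> B \<in> carrier_mat n n \<and> (\<forall>l<n. bounded_module (\<bb> l)) \<and> span_mod n \<gg> \<bb> B = M"

text \<open>Records that the columns from \<open>m\<close> on are finished. The diagonal entry of
  column 0 is exempt, as the inner loop is empty for \<open>j = 0\<close> and never creates a pivot
  there.\<close>

definition reduced_from :: "nat \<Rightarrow> nat \<Rightarrow> 'k::field_char_0 mat \<Rightarrow> bool" where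
  "reduced_from n m B \<longleftrightarrow> (\<forall>j<n. m \<le> j \<longrightarrow> (\<forall>i<j. B $$ (i, j) = 0) \<and> (0 < j \<longrightarrow> B $$ (j, j) = 1))"

text \<open>The transformation of the two rows has determinant \<open>p * u + q * v = 1\<close>, and
  both it and its inverse respect the chosen ideals. Reduction alters row \<open>l\<close> modulo
  \<open>\<gg>\<close> times the inverse of \<open>\<bb>' l\<close>, which becomes a change modulo
  \<open>\<gg>\<close> after multiplication by elements of \<open>\<bb>' l\<close>.\<close>

lemma hnf_invariant_step:
  assumes K: "number_field TYPE('k::field_char_0)" and g: "integer_module (\<gg> :: 'k set)"
    and step: "hnf_step n \<gg> (j, i) (B, \<bb>) (B', \<bb>')"
    and ij: "i < n" "j < n" "i \<noteq> j"
    and inv: "hnf_invariant n \<gg> M B \<bb>"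
  shows "hnf_invariant n \<gg> M B' \<bb>'"
proof -
  have B: "B \<in> carrier_mat n n" and b: "\<And>l. l < n \<Longrightarrow> bounded_module (\<bb> l)"
    and M: "span_mod n \<gg> \<bb> B = M"
    using inv by (auto simp: hnf_invariant_def)
  obtain p q \<dd> u v c where pq: "p = B $$ (i, j)" "q = B $$ (j, j)"
    and pqd: "\<dd> = p *o \<bb> i + q *o \<bb> j" "bounded_module \<dd>"
    and uv: "u \<in> \<bb> i \<cdot>\<^sub>I ideal_inverse \<dd>" "v \<in> \<bb> j \<cdot>\<^sub>I ideal_inverse \<dd>" "p * u + q * v = 1"
    and c: "c \<noteq> 0" "\<bb>' i = c *o (\<bb> i \<cdot>\<^sub>I \<bb> j \<cdot>\<^sub>I ideal_inverse \<dd>)" "bounded_module (\<bb>' i)"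
    and b': "\<bb>' j = \<dd>" "\<forall>l. l \<noteq> i \<and> l \<noteq> j \<longrightarrow> \<bb>' l = \<bb> l" and B': "B' \<in> carrier_mat n n"
    and r1: "\<forall>k<n. reduces (\<gg> \<cdot>\<^sub>I ideal_inverse (\<bb>' i)) (inverse c * (q * B $$ (i, k) - p * B $$ (j, k))) (B' $$ (i, k))"
    and r2: "\<forall>k<n. reduces (\<gg> \<cdot>\<^sub>I ideal_inverse \<dd>) (u * B $$ (i, k) + v * B $$ (j, k)) (B' $$ (j, k))"
    and r3: "\<forall>l<n. \<forall>k<n. l \<noteq> i \<and> l \<noteq> j \<longrightarrow> B' $$ (l, k) = B $$ (l, k)"
    by (rule hnf_stepE[OF K step ij(1) ij(2) B b[OF ij(1)] b[OF ij(2)]])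
  have bb': "bounded_module (\<bb>' l)" if "l < n" for l
    using that b c(3) b' pqd(2) by (cases "l = i"; cases "l = j") auto
  have bm: "\<And>l. l < n \<Longrightarrow> integer_module (\<bb> l)" and bm': "\<And>l. l < n \<Longrightarrow> integer_module (\<bb>' l)"
    using b bb' by (auto simp: bounded_module_integer_module)
  note inv_mod = integer_module_ideal_mult[OF integer_module_inverse]
  have V: "vector_module n (span_mod n \<gg> \<bb> B)" and V': "vector_module n (span_mod n \<gg> \<bb>' B')"
    by (intro vector_module_span_mod g bm bm'; assumption)+
  have pd: "p * a \<in> \<dd>" if "a \<in> \<bb> i" for a
    unfolding pqd(1) using that bm[OF ij(2)]
    by (intro integer_module_plus_left integer_module_scale) auto
  have qd: "q * a \<in> \<dd>" if "a \<in> \<bb> j" for a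
    unfolding pqd(1) using that bm[OF ij(1)]
    by (intro integer_module_plus_right integer_module_scale) auto
  have e1: "x * (inverse c * (q * B $$ (i, k) - p * B $$ (j, k))) - x * B' $$ (i, k) \<in> \<gg>"
    "x * B' $$ (i, k) - x * (inverse c * (q * B $$ (i, k) - p * B $$ (j, k))) \<in> \<gg>"
    if "x \<in> \<bb>' i" "k < n" for x k
  proof -
    have "(B' $$ (i, k) - inverse c * (q * B $$ (i, k) - p * B $$ (j, k))) * x \<in> \<gg>"
      by (rule ideal_mult_inverse_mult[OF g reduces_diff[OF inv_mod r1[rule_format, OF that(2)]] that(1)])
    then show *: "x * B' $$ (i, k) - x * (inverse c * (q * B $$ (i, k) - p * B $$ (j, k))) \<in> \<gg>"
      by (simp add: algebra_simps)
    show "x * (inverse c * (q * B $$ (i, k) - p * B $$ (j, k))) - x * B' $$ (i, k) \<in> \<gg>"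
      using integer_module_uminus[OF g *] by simp
  qed
  have e2: "x * (u * B $$ (i, k) + v * B $$ (j, k)) - x * B' $$ (j, k) \<in> \<gg>"
    "x * B' $$ (j, k) - x * (u * B $$ (i, k) + v * B $$ (j, k)) \<in> \<gg>"
    if "x \<in> \<dd>" "k < n" for x k
  proof -
    have "(B' $$ (j, k) - (u * B $$ (i, k) + v * B $$ (j, k))) * x \<in> \<gg>"
      by (rule ideal_mult_inverse_mult[OF g reduces_diff[OF inv_mod r2[rule_format, OF that(2)]] that(1)])
    then show *: "x * B' $$ (j, k) - x * (u * B $$ (i, k) + v * B $$ (j, k)) \<in> \<gg>"
      by (simp add: algebra_simps)
    show "x * (u * B $$ (i, k) + v * B $$ (j, k)) - x * B' $$ (j, k) \<in> \<gg>"
      using integer_module_uminus[OF g *] by simp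
  qed
  have "span_mod n \<gg> \<bb>' B' \<subseteq> span_mod n \<gg> \<bb> B"
  proof (rule span_mod_subset[OF V])
    fix f assume "\<And>k. k < n \<Longrightarrow> f k \<in> \<gg>"
    then show "f \<in> span_mod n \<gg> \<bb> B" by (intro span_mod_modulus bm)
  next
    fix l x assume l: "l < n" and x: "x \<in> \<bb>' l"
    have base: "(\<lambda>k. y * B $$ (s, k)) \<in> span_mod n \<gg> \<bb> B" if "s < n" "y \<in> \<bb> s" for y s
    proof (rule span_mod_base[where I = \<bb>, OF g bm that])
      fix k
      show "y * B $$ (s, k) - y * B $$ (s, k) \<in> \<gg>" using integer_module_0[OF g] by simp
    qed
    consider "l = i" | "l = j" | "l \<noteq> i" "l \<noteq> j" by blast
    then show "(\<lambda>k. x * B' $$ (l, k)) \<in> span_mod n \<gg> \<bb> B"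
    proof cases
      case 1
      then obtain z where z: "z \<in> \<bb> i \<cdot>\<^sub>I \<bb> j \<cdot>\<^sub>I ideal_inverse \<dd>" "x = c * z"
        using x c(2) by (auto simp: elt_set_times_def)
      \<comment> \<open>Both coefficients of the row \<open>q B_i - p B_j\<close>, multiplied by
        \<open>z\<close>, fall back into the old ideals.\<close>
      have zq: "z * q \<in> \<bb> i" by (rule mult_inverse_mem[OF bm[OF ij(1)] z(1) qd])
      have zp: "z * p \<in> \<bb> j"
        by (rule mult_inverse_mem[OF bm[OF ij(2)] z(1)[unfolded ideal_mult_commute[of "\<bb> i" "\<bb> j"]] pd])
      have "(\<lambda>k. x * B' $$ (i, k) - x * (inverse c * (q * B $$ (i, k) - p * B $$ (j, k)))) \<in> span_mod n \<gg> \<bb> B"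
        by (rule span_mod_modulus[where I = \<bb>, OF bm e1(2)]) (use x 1 in simp_all)
      then have "(\<lambda>k. (z * q * B $$ (i, k) - z * p * B $$ (j, k))
          + (x * B' $$ (i, k) - x * (inverse c * (q * B $$ (i, k) - p * B $$ (j, k))))) \<in> span_mod n \<gg> \<bb> B"
        by (rule vector_module_add[OF V vector_module_diff[OF V base[OF ij(1) zq] base[OF ij(2) zp]]])
      then show ?thesis
      proof (rule vector_module_cong[OF V])
        fix k
        have "x * (inverse c * (q * B $$ (i, k) - p * B $$ (j, k))) = z * (q * B $$ (i, k) - p * B $$ (j, k))"
          using c(1) by (simp add: z(2))
        then show "x * B' $$ (l, k) = (z * q * B $$ (i, k) - z * p * B $$ (j, k))
          + (x * B' $$ (i, k) - x * (inverse c * (q * B $$ (i, k) - p * B $$ (j, k))))"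
          by (simp only: 1) (simp add: algebra_simps)
      qed
    next
      case 2
      have xu: "x * u \<in> \<bb> i" "x * v \<in> \<bb> j"
        using ideal_mult_inverse_mult[OF bm[OF ij(1)] uv(1)] ideal_mult_inverse_mult[OF bm[OF ij(2)] uv(2)]
          x 2 b'(1) by (simp_all add: mult.commute[of x])
      have "(\<lambda>k. x * B' $$ (j, k) - x * (u * B $$ (i, k) + v * B $$ (j, k))) \<in> span_mod n \<gg> \<bb> B"
        by (rule span_mod_modulus[where I = \<bb>, OF bm e2(2)]) (use x 2 b'(1) in simp_all)
      then have "(\<lambda>k. (x * u * B $$ (i, k) + x * v * B $$ (j, k))
          + (x * B' $$ (j, k) - x * (u * B $$ (i, k) + v * B $$ (j, k)))) \<in> span_mod n \<gg> \<bb> B"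
        by (intro vector_module_add[OF V] base ij xu)
      then show ?thesis
        by (rule vector_module_cong[OF V]) (simp add: 2 algebra_simps)
    next
      case 3
      then show ?thesis
        using vector_module_cong[OF V base[OF l]] x b'(2) r3 l by simp
    qed
  qed
  moreover have "span_mod n \<gg> \<bb> B \<subseteq> span_mod n \<gg> \<bb>' B'"
  proof (rule span_mod_subset[OF V'])
    fix f assume "\<And>k. k < n \<Longrightarrow> f k \<in> \<gg>"
    then show "f \<in> span_mod n \<gg> \<bb>' B'" by (intro span_mod_modulus bm')
  next
    fix l x assume l: "l < n" and x: "x \<in> \<bb> l"
    have base_i: "(\<lambda>k. z * (q * B $$ (i, k) - p * B $$ (j, k))) \<in> span_mod n \<gg> \<bb>' B'"
      if z: "z \<in> \<bb> i \<cdot>\<^sub>I \<bb> j \<cdot>\<^sub>I ideal_inverse \<dd>" for z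
    proof -
      have cz: "c * z \<in> \<bb>' i" using z c(2) by auto
      have eq: "c * z * (inverse c * w) = z * w" for w using c(1) by simp
      have "z * (q * B $$ (i, k) - p * B $$ (j, k)) - c * z * B' $$ (i, k) \<in> \<gg>" if "k < n" for k
        using e1(1)[OF cz that] unfolding eq .
      then show ?thesis
        by (intro span_mod_base[where I = \<bb>' and x = "c * z", OF g bm' ij(1) cz])
    qed
    have base_j: "(\<lambda>k. z * (u * B $$ (i, k) + v * B $$ (j, k))) \<in> span_mod n \<gg> \<bb>' B'"
      if z: "z \<in> \<dd>" for z
      by (rule span_mod_base[where I = \<bb>', OF g bm' ij(2)]) (use z b'(1) e2(1) in auto)
    consider "l = i" | "l = j" | "l \<noteq> i" "l \<noteq> j" by blast
    then show "(\<lambda>k. x * B $$ (l, k)) \<in> span_mod n \<gg> \<bb>' B'"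
    proof cases
      case 1
      \<comment> \<open>The inverse transformation recovers \<open>B_i\<close> as \<open>v\<close>
        times the new row \<open>i\<close> plus \<open>p\<close> times the new row \<open>j\<close>,
        up to normalization and reduction.\<close>
      have "(\<lambda>k. (x * v) * (q * B $$ (i, k) - p * B $$ (j, k))
          + (p * x) * (u * B $$ (i, k) + v * B $$ (j, k))) \<in> span_mod n \<gg> \<bb>' B'"
        using x 1 by (intro vector_module_add[OF V'] base_i base_j pd mult_mem_mult_inverse uv) auto
      then show ?thesis
      proof (rule vector_module_cong[OF V'])
        fix k
        have "(x * v) * (q * B $$ (i, k) - p * B $$ (j, k)) + (p * x) * (u * B $$ (i, k) + v * B $$ (j, k))
          = x * (p * u + q * v) * B $$ (i, k)" by (simp add: algebra_simps)
        then show "x * B $$ (l, k) = (x * v) * (q * B $$ (i, k) - p * B $$ (j, k))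
            + (p * x) * (u * B $$ (i, k) + v * B $$ (j, k))"
          by (simp add: 1 uv(3))
      qed
    next
      case 2
      have xu: "x * u \<in> \<bb> i \<cdot>\<^sub>I \<bb> j \<cdot>\<^sub>I ideal_inverse \<dd>"
        using mult_mem_mult_inverse[OF _ uv(1), of x "\<bb> j"] x 2 by (simp add: ideal_mult_commute[of "\<bb> i" "\<bb> j"])
      \<comment> \<open>Likewise \<open>B_j\<close> is \<open>q\<close> times the new row
        \<open>j\<close> minus \<open>u\<close> times the new row \<open>i\<close>.\<close>
      have "(\<lambda>k. (q * x) * (u * B $$ (i, k) + v * B $$ (j, k))
          - (x * u) * (q * B $$ (i, k) - p * B $$ (j, k))) \<in> span_mod n \<gg> \<bb>' B'"
        using x 2 xu by (intro vector_module_diff[OF V'] base_i base_j qd) auto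
      then show ?thesis
      proof (rule vector_module_cong[OF V'])
        fix k
        have "(q * x) * (u * B $$ (i, k) + v * B $$ (j, k)) - (x * u) * (q * B $$ (i, k) - p * B $$ (j, k))
          = x * (p * u + q * v) * B $$ (j, k)" by (simp add: algebra_simps)
        then show "x * B $$ (l, k) = (q * x) * (u * B $$ (i, k) + v * B $$ (j, k))
            - (x * u) * (q * B $$ (i, k) - p * B $$ (j, k))"
          by (simp add: 2 uv(3))
      qed
    next
      case 3
      show ?thesis
        by (rule span_mod_base[where I = \<bb>', OF g bm' l]) (use x 3 b'(2) r3 l integer_module_0[OF g] in auto)
    qed
  qed
  ultimately show ?thesis using B' bb' M by (simp add: hnf_invariant_def)
qed

text \<open>Before reduction the pivot is \<open>p * u + q * v = 1\<close> and the eliminated entry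
  is a multiple of \<open>q * p - p * q = 0\<close>; reduction fixes both. A column in which both
  rows vanish is untouched, so finished columns survive.\<close>

lemma hnf_step_entries:
  assumes K: "number_field TYPE('k::field_char_0)"
    and step: "hnf_step n (\<gg> :: 'k set) (j, i) (B, \<bb>) (B', \<bb>')"
    and ij: "i < j" "j < n"
    and inv: "hnf_invariant n \<gg> M B \<bb>"
  shows "B' $$ (j, j) = 1" and "B' $$ (i, j) = 0"
    and "\<And>l k. l < n \<Longrightarrow> l \<noteq> i \<Longrightarrow> l \<noteq> j \<Longrightarrow> k < n \<Longrightarrow> B' $$ (l, k) = B $$ (l, k)"
    and "\<And>k. k < n \<Longrightarrow> B $$ (i, k) = 0 \<Longrightarrow> B $$ (j, k) = 0 \<Longrightarrow> B' $$ (i, k) = 0 \<and> B' $$ (j, k) = 0"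
proof -
  have B: "B \<in> carrier_mat n n" and b: "\<And>l. l < n \<Longrightarrow> bounded_module (\<bb> l)"
    using inv by (auto simp: hnf_invariant_def)
  have i: "i < n" using ij by simp
  obtain p q \<dd> u v c where pq: "p = B $$ (i, j)" "q = B $$ (j, j)"
    and pqd: "\<dd> = p *o \<bb> i + q *o \<bb> j" "bounded_module \<dd>"
    and uv: "u \<in> \<bb> i \<cdot>\<^sub>I ideal_inverse \<dd>" "v \<in> \<bb> j \<cdot>\<^sub>I ideal_inverse \<dd>" "p * u + q * v = 1"
    and c: "c \<noteq> 0" "\<bb>' i = c *o (\<bb> i \<cdot>\<^sub>I \<bb> j \<cdot>\<^sub>I ideal_inverse \<dd>)" "bounded_module (\<bb>' i)"
    and b': "\<bb>' j = \<dd>" "\<forall>l. l \<noteq> i \<and> l \<noteq> j \<longrightarrow> \<bb>' l = \<bb> l" and B': "B' \<in> carrier_mat n n"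
    and r1: "\<forall>k<n. reduces (\<gg> \<cdot>\<^sub>I ideal_inverse (\<bb>' i)) (inverse c * (q * B $$ (i, k) - p * B $$ (j, k))) (B' $$ (i, k))"
    and r2: "\<forall>k<n. reduces (\<gg> \<cdot>\<^sub>I ideal_inverse \<dd>) (u * B $$ (i, k) + v * B $$ (j, k)) (B' $$ (j, k))"
    and r3: "\<forall>l<n. \<forall>k<n. l \<noteq> i \<and> l \<noteq> j \<longrightarrow> B' $$ (l, k) = B $$ (l, k)"
    by (rule hnf_stepE[OF K step i ij(2) B b[OF i] b[OF ij(2)]])
  show "B' $$ (j, j) = 1"
    using r2[rule_format, OF ij(2)] uv(3) by (intro reduces_1) (simp add: pq mult.commute)
  show "B' $$ (i, j) = 0"
    using r1[rule_format, OF ij(2)] by (intro reduces_0) (simp add: pq mult.commute)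
  show "B' $$ (l, k) = B $$ (l, k)" if "l < n" "l \<noteq> i" "l \<noteq> j" "k < n" for l k
    using r3 that by blast
  show "B' $$ (i, k) = 0 \<and> B' $$ (j, k) = 0" if "k < n" "B $$ (i, k) = 0" "B $$ (j, k) = 0" for k
    using r1[rule_format, OF that(1)] r2[rule_format, OF that(1)] that(2,3) by (auto intro: reduces_0)
qed

lemma hnf_steps_append:
  "hnf_steps n \<gg> (xs @ ys) s s' \<longleftrightarrow> (\<exists>t. hnf_steps n \<gg> xs s t \<and> hnf_steps n \<gg> ys t s')"
  by (induction xs arbitrary: s) auto

text \<open>The rows below \<open>k\<close> are still to be treated. The pivot is 1 only after at
  least one pass, hence the guard \<open>k < j\<close>; for \<open>j = 0\<close> no pass takes
  place.\<close>

lemma hnf_steps_column: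
  assumes K: "number_field TYPE('k::field_char_0)" and g: "integer_module (\<gg> :: 'k set)"
    and "hnf_steps n \<gg> (map (\<lambda>i. (j, i)) (rev [0..<k])) (B, \<bb>) (B', \<bb>')"
    and "k \<le> j" "j < n" "hnf_invariant n \<gg> M B \<bb>" "reduced_from n (Suc j) B"
    and "\<And>i. k \<le> i \<Longrightarrow> i < j \<Longrightarrow> B $$ (i, j) = 0" and "k < j \<Longrightarrow> B $$ (j, j) = 1"
  shows "hnf_invariant n \<gg> M B' \<bb>' \<and> reduced_from n j B'"
  using assms(3-)
proof (induction k arbitrary: B \<bb>)
  case 0
  then have eq: "B' = B" "\<bb>' = \<bb>" by simp_all
  have "reduced_from n j B"
    unfolding reduced_from_def
  proof (intro allI impI)
    fix l assume "l < n" "j \<le> l"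
    then show "(\<forall>i<l. B $$ (i, l) = 0) \<and> (0 < l \<longrightarrow> B $$ (l, l) = 1)"
      using 0 by (cases "l = j") (auto simp: reduced_from_def)
  qed
  then show ?case using 0 eq by simp
next
  case (Suc k)
  then obtain C \<cc> where step: "hnf_step n \<gg> (j, k) (B, \<bb>) (C, \<cc>)"
    and steps: "hnf_steps n \<gg> (map (\<lambda>i. (j, i)) (rev [0..<k])) (C, \<cc>) (B', \<bb>')"
    by auto
  have kj: "k < j" "k < n" using Suc.prems by auto
  note ent = hnf_step_entries[OF K step kj(1) \<open>j < n\<close> \<open>hnf_invariant n \<gg> M B \<bb>\<close>]
  show ?case
  proof (rule Suc.IH[OF steps])
    show "hnf_invariant n \<gg> M C \<cc>"
      using Suc.prems kj by (intro hnf_invariant_step[OF K g step]) auto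
    show "reduced_from n (Suc j) C"
      unfolding reduced_from_def
    proof (intro allI impI conjI)
      fix l i assume l: "l < n" "Suc j \<le> l" and i: "i < l"
      have z: "B $$ (i, l) = 0" "B $$ (k, l) = 0" "B $$ (j, l) = 0"
        using \<open>reduced_from n (Suc j) B\<close> l i kj by (auto simp: reduced_from_def)
      show "C $$ (i, l) = 0"
        using ent(3)[of i l] ent(4)[OF l(1) z(2,3)] z l i by (cases "i = k \<or> i = j") auto
    next
      fix l assume l: "l < n" "Suc j \<le> l" "0 < l"
      then show "C $$ (l, l) = 1"
        using ent(3)[of l l] \<open>reduced_from n (Suc j) B\<close> kj by (auto simp: reduced_from_def)
    qed
    show "C $$ (i, j) = 0" if "k \<le> i" "i < j" for i
      using ent(2) ent(3)[of i j] Suc.prems(6)[of i] that \<open>j < n\<close> by (cases "i = k") auto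
    show "C $$ (j, j) = 1" by (rule ent(1))
  qed (use kj \<open>j < n\<close> in auto)
qed

lemma hnf_steps_all_columns:
  assumes K: "number_field TYPE('k::field_char_0)" and g: "integer_module (\<gg> :: 'k set)"
    and "hnf_steps n \<gg> [(j, i). j \<leftarrow> rev [0..<m], i \<leftarrow> rev [0..<j]] (B, \<bb>) (B', \<bb>')"
    and "m \<le> n" "hnf_invariant n \<gg> M B \<bb>" "reduced_from n m B"
  shows "hnf_invariant n \<gg> M B' \<bb>' \<and> reduced_from n 0 B'"
  using assms(3-)
proof (induction m arbitrary: B \<bb>)
  case (Suc m)
  then obtain C \<cc> where col: "hnf_steps n \<gg> (map (\<lambda>i. (m, i)) (rev [0..<m])) (B, \<bb>) (C, \<cc>)"
    and rest: "hnf_steps n \<gg> [(j, i). j \<leftarrow> rev [0..<m], i \<leftarrow> rev [0..<j]] (C, \<cc>) (B', \<bb>')"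
    by (auto simp: hnf_steps_append)
  have "hnf_invariant n \<gg> M C \<cc> \<and> reduced_from n m C"
    by (rule hnf_steps_column[OF K g col]) (use Suc.prems in auto)
  then show ?case using Suc.IH[OF rest] Suc.prems(2) by simp
qed simp

section \<open>Algorithm E\<close>

text \<open>Splits a vector into its coordinate components, so that membership can be checked one
  entry at a time.\<close>

lemma vector_module_unit_vectors:
  assumes S: "vector_module n S"
    and unit: "\<And>k. k < j \<Longrightarrow> (\<lambda>k'. if k' = k then f k else 0) \<in> S"
    and zero: "\<And>k. j \<le> k \<Longrightarrow> k < n \<Longrightarrow> f k = 0"
  shows "f \<in> S"
proof -
  have "(\<lambda>k'. \<Sum>k<j. if k' = k then f k else 0) \<in> S"
    by (rule vector_module_sum[OF S]) (simp add: unit)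
  then show ?thesis
  proof (rule vector_module_cong[OF S])
    fix k assume "k < n"
    then show "f k = (\<Sum>k'<j. if k = k' then f k' else 0)" using zero[of k] by simp
  qed
qed

lemma fdet_unitriangular:
  assumes "\<And>i k. i < k \<Longrightarrow> k < n \<Longrightarrow> w i k = 0" and "\<And>i. i < n \<Longrightarrow> w i i = 1"
  shows "fdet n w = 1"
proof -
  have "det (mat n n (\<lambda>(i, k). w i k)) = prod_list (diag_mat (mat n n (\<lambda>(i, k). w i k)))"
    by (rule det_lower_triangular[of n]) (simp_all add: assms(1))
  also have "diag_mat (mat n n (\<lambda>(i, k). w i k)) = map (\<lambda>_. 1) [0..<n]"
    by (simp add: diag_mat_def assms(2))
  finally show ?thesis by (simp add: fdet_def map_replicate_const)
qed

text \<open>Collects what both algorithms provide, with the choices of \<open>u\<close> and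
  \<open>v\<close> made into functions of the row. Reductions survive only as the congruence
  \<open>W_cong\<close>, which includes the diagonal, and as the zeros
  \<open>W_upper\<close>.\<close>

locale reconstruction =
  fixes n :: nat and A W :: "nat \<Rightarrow> nat \<Rightarrow> 'k::field_char_0" and B :: "'k mat"
    and \<aa> \<bb> \<cc> G :: "nat \<Rightarrow> 'k set" and u v :: "nat \<Rightarrow> 'k"
  assumes n: "0 < n"
    and a: "l < n \<Longrightarrow> integer_module (\<aa> l)" and b: "l < n \<Longrightarrow> integer_module (\<bb> l)"
    and integral: "f \<in> row_span n \<aa> A \<Longrightarrow> k < n \<Longrightarrow> f k \<in> ring_of_integers"
    and Gn: "G n = fdet n A *o ideal_prod n \<aa>"
    and B_span: "span_mod n (G n) \<bb> B = row_span n \<aa> A"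
    and B_upper: "i < j \<Longrightarrow> j < n \<Longrightarrow> B $$ (i, j) = 0"
    and B_diag: "0 < j \<Longrightarrow> j < n \<Longrightarrow> B $$ (j, j) = 1"
    and c_eq: "j < n \<Longrightarrow> \<cc> j = \<bb> j + G (Suc j)"
    and G_eq: "j < n \<Longrightarrow> G j = G (Suc j) \<cdot>\<^sub>I ideal_inverse (\<cc> j)"
    and u: "j < n \<Longrightarrow> u j \<in> \<bb> j \<cdot>\<^sub>I ideal_inverse (\<cc> j)"
    and v: "j < n \<Longrightarrow> v j \<in> G (Suc j) \<cdot>\<^sub>I ideal_inverse (\<cc> j)"
    and uv: "j < n \<Longrightarrow> u j + v j = 1"
    and W_cong: "j < n \<Longrightarrow> k < n \<Longrightarrow> W j k - u j * B $$ (j, k) \<in> G j"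
    and W_upper: "i < j \<Longrightarrow> j < n \<Longrightarrow> W i j = 0"
    and W_diag: "j < n \<Longrightarrow> W j j = 1"
begin

abbreviation M :: "(nat \<Rightarrow> 'k) set" where
  "M \<equiv> row_span n \<aa> A"

lemma M_module: "vector_module n M"
  by (rule vector_module_row_span[OF a])

lemma G_module: "j \<le> n \<Longrightarrow> integer_module (G j)"
  by (cases "j = n")
    (simp_all add: Gn G_eq integer_module_scale integer_module_ideal_prod
      integer_module_ideal_mult integer_module_inverse)

lemma c_module: "j < n \<Longrightarrow> integer_module (\<cc> j)"
  by (simp add: c_eq integer_module_plus b G_module)

lemma b_in_c: "j < n \<Longrightarrow> x \<in> \<bb> j \<Longrightarrow> x \<in> \<cc> j"
  unfolding c_eq by (rule integer_module_plus_left[OF G_module]) auto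

lemma G_Suc_in_c: "j < n \<Longrightarrow> x \<in> G (Suc j) \<Longrightarrow> x \<in> \<cc> j"
  unfolding c_eq by (rule integer_module_plus_right[OF b])

lemma G_mult_c: "j < n \<Longrightarrow> y \<in> G j \<Longrightarrow> t \<in> \<cc> j \<Longrightarrow> y * t \<in> G (Suc j)"
  unfolding G_eq by (rule ideal_mult_inverse_mult[OF G_module]) auto

lemma u_mult_c: "j < n \<Longrightarrow> t \<in> \<cc> j \<Longrightarrow> u j * t \<in> \<bb> j"
  by (rule ideal_mult_inverse_mult[OF b u])

text \<open>In other words \<open>u j\<close> is congruent to 1 modulo \<open>G j\<close>.\<close>

lemma v_in_G: "j < n \<Longrightarrow> v j \<in> G j"
  unfolding G_eq by (rule v)

lemma bB_in_M:
  assumes "i < n" and "x \<in> \<bb> i"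
  shows "(\<lambda>k. x * B $$ (i, k)) \<in> M"
  unfolding B_span[symmetric]
  by (rule span_mod_base[where I = \<bb> and x = x, OF G_module b assms])
    (simp_all add: integer_module_0[OF G_module])

lemma bB_integral: "i < n \<Longrightarrow> k < n \<Longrightarrow> x \<in> \<bb> i \<Longrightarrow> x * B $$ (i, k) \<in> ring_of_integers"
  using integral[OF bB_in_M, of i x k] by simp

lemma G_integral:
  assumes "j \<le> n" and "y \<in> G j"
  shows "y \<in> ring_of_integers"
proof (cases "j = n")
  case True
  \<comment> \<open>The constant vector with entry \<open>y\<close> lies in \<open>G n O^n\<close>,
    hence in the integral module \<open>M\<close>.\<close>
  have "(\<lambda>_. y) \<in> M"
    unfolding B_span[symmetric] by (rule span_mod_modulus[where I = \<bb>, OF b]) (use assms True in auto)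
  then show ?thesis using integral n by blast
next
  case False
  then have j: "j < n" using assms(1) by simp
  have "G (Suc j) \<cdot>\<^sub>I ideal_inverse (\<cc> j) \<subseteq> ring_of_integers"
  proof (rule ideal_mult_subset[OF integer_module_ring_of_integers])
    fix a b assume "a \<in> G (Suc j)" "b \<in> ideal_inverse (\<cc> j)"
    then show "a * b \<in> ring_of_integers"
      using ideal_inverseD[of b _ a] G_Suc_in_c[OF j] by (simp add: mult.commute)
  qed
  then show ?thesis using assms(2) G_eq[OF j] by blast
qed

text \<open>Together with \<open>W'\<close> this is a pseudo-basis of the module \<open>L\<close>
  that completes the rows from \<open>j\<close> on by standard unit vectors over the ring of
  integers; its matrix is unitriangular.\<close>

definition \<cc>' :: "nat \<Rightarrow> nat \<Rightarrow> 'k set" where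
  "\<cc>' j l = (if l < j then ring_of_integers else \<cc> l)"

definition W' :: "nat \<Rightarrow> nat \<Rightarrow> nat \<Rightarrow> 'k" where
  "W' j l k = (if l < j then if k = l then 1 else 0 else W l k)"

lemma c'_module: "l < n \<Longrightarrow> integer_module (\<cc>' j l)"
  by (simp add: \<cc>'_def integer_module_ring_of_integers c_module)

lemma fdet_W': "fdet n (W' j) = 1"
  by (rule fdet_unitriangular) (auto simp: W'_def W_upper W_diag)

text \<open>Going from \<open>Suc j\<close> to \<open>j\<close> multiplies \<open>G\<close> by the
  inverse of \<open>\<cc> j\<close> and puts \<open>\<cc> j\<close> in place of the unit ideal in
  the product, so an element of that inverse compensates for the new factor.\<close>

lemma G_subset_quotient:
  assumes "j \<le> n"
  shows "G j \<subseteq> G n \<cdot>\<^sub>I ideal_inverse (ideal_prod n (\<cc>' j))"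
  using assms
proof (induction rule: inc_induct)
  case base
  have "ideal_prod n (\<cc>' n) \<subseteq> ring_of_integers"
    by (rule ideal_prod_subset[OF integer_module_ring_of_integers])
      (auto simp: \<cc>'_def intro!: ring_of_integers_prod)
  then have "1 \<in> ideal_inverse (ideal_prod n (\<cc>' n))"
    by (auto simp: ideal_inverse_def)
  then show ?case using ideal_mult_memI[of _ "G n" 1] by fastforce
next
  case (step j)
  have "y * e \<in> G n \<cdot>\<^sub>I ideal_inverse (ideal_prod n (\<cc>' j))"
    if y: "y \<in> G n \<cdot>\<^sub>I ideal_inverse (ideal_prod n (\<cc>' (Suc j)))" and e: "e \<in> ideal_inverse (\<cc> j)" for y e
    using y
  proof (induction rule: ideal_mult_induct)
    case (step z g w)
    have "ideal_prod n (\<cc>' j) \<subseteq> {x. w * e * x \<in> ring_of_integers}"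
    proof (rule ideal_prod_subset)
      show "integer_module {x. w * e * x \<in> ring_of_integers}"
        unfolding integer_module_def
        by (auto simp: distrib_left ring_of_integers_add mult.left_commute[of "w * e"] ring_of_integers_mult)
    next
      fix t assume t: "\<And>i. i < n \<Longrightarrow> t i \<in> \<cc>' j i"
      \<comment> \<open>The factor \<open>e\<close> is absorbed into slot \<open>j\<close>: there
        \<open>e * t j\<close> is integral, as \<open>\<cc>' (Suc j) j\<close> asks.\<close>
      define t' where "t' = t(j := e * t j)"
      have "t' i \<in> \<cc>' (Suc j) i" if "i < n" for i
        using t[OF that] ideal_inverseD[OF e, of "t j"] by (auto simp: t'_def \<cc>'_def split: if_splits)
      then have "w * (\<Prod>i<n. t' i) \<in> ring_of_integers"
        by (intro ideal_inverseD[OF step.hyps(3)] prod_mem_ideal_prod)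
      moreover have "(\<Prod>i<n. t' i) = e * (\<Prod>i<n. t i)"
        using \<open>j < n\<close> by (simp add: t'_def prod.remove[of "{..<n}" j])
      ultimately show "(\<Prod>i<n. t i) \<in> {x. w * e * x \<in> ring_of_integers}"
        by (simp add: mult.assoc)
    qed
    then have "w * e \<in> ideal_inverse (ideal_prod n (\<cc>' j))" by (auto simp: ideal_inverse_def)
    moreover have "(z + g * w) * e = z * e + g * (w * e)" by (simp add: algebra_simps)
    ultimately show ?case using step by (simp add: ideal_mult_add_product)
  qed (simp add: ideal_mult_0)
  then show ?case
    unfolding G_eq[OF \<open>j < n\<close>] using step.IH
    by (intro ideal_mult_subset integer_module_ideal_mult integer_module_inverse) blast
qed

lemma G_mult_W'_in_M:
  assumes sub: "M \<subseteq> row_span n (\<cc>' j) (W' j)" and "j \<le> n" and y: "y \<in> G j"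
    and l: "l < n" and t: "t \<in> \<cc>' j l"
  shows "(\<lambda>k. y * t * W' j l k) \<in> M"
proof -
  have gens: "(\<lambda>k. z * A i k) \<in> row_span n (\<cc>' j) (W' j)" if "i < n" "z \<in> \<aa> i" for i z
    using sub row_span_base[where I = \<aa> and a = A, OF a that] by blast
  have "G n \<cdot>\<^sub>I ideal_inverse (ideal_prod n (\<cc>' j)) \<subseteq> {y. (\<lambda>k. y * t * W' j l k) \<in> M}"
  proof (rule ideal_mult_subset)
    show "integer_module {y. (\<lambda>k. y * t * W' j l k) \<in> M}"
      unfolding integer_module_def
    proof (intro conjI ballI)
      show "0 \<in> {y. (\<lambda>k. y * t * W' j l k) \<in> M}" using vector_module_0[OF M_module] by simp
    next
      fix x y assume "x \<in> {y. (\<lambda>k. y * t * W' j l k) \<in> M}" "y \<in> {y. (\<lambda>k. y * t * W' j l k) \<in> M}"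
      then have "(\<lambda>k. x * t * W' j l k + y * t * W' j l k) \<in> M"
        by (intro vector_module_add[OF M_module]) simp_all
      then show "x + y \<in> {y. (\<lambda>k. y * t * W' j l k) \<in> M}" by (simp add: distrib_right)
    next
      fix r y :: 'k assume "r \<in> ring_of_integers" "y \<in> {y. (\<lambda>k. y * t * W' j l k) \<in> M}"
      then have "(\<lambda>k. y * t * W' j l k) \<in> M" by simp
      from vector_module_mult[OF M_module \<open>r \<in> ring_of_integers\<close> this]
      show "r * y \<in> {y. (\<lambda>k. y * t * W' j l k) \<in> M}" by (simp add: mult.assoc)
    qed
  next
    fix g w assume "g \<in> G n" "w \<in> ideal_inverse (ideal_prod n (\<cc>' j))"
    then have "(\<lambda>k. w * g * t * W' j l k) \<in> M"
      unfolding Gn by (intro fdet_mult_row_mem_row_span[OF a c'_module gens fdet_W' _ _ l t])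
    then show "g * w \<in> {y. (\<lambda>k. y * t * W' j l k) \<in> M}" by (simp add: mult.commute[of g])
  qed
  then show ?thesis using G_subset_quotient[OF \<open>j \<le> n\<close>] y by blast
qed

section \<open>Downward induction over the rows\<close>

definition mixed_generators :: "nat \<Rightarrow> (nat \<Rightarrow> 'k) set \<Rightarrow> bool" where
  "mixed_generators j S \<longleftrightarrow>
     (\<forall>i<j. \<forall>x\<in>\<bb> i. (\<lambda>k. x * B $$ (i, k)) \<in> S) \<and>
     (\<forall>l<j. \<forall>y\<in>G j. (\<lambda>k. if k = l then y else 0) \<in> S) \<and>
     (\<forall>l. j \<le> l \<and> l < n \<longrightarrow> (\<forall>t\<in>\<cc> l. (\<lambda>k. t * W l k) \<in> S))"

text \<open>The claim of the induction; the universal property avoids writing out a sum of three families.\<close>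

definition spanned_by :: "nat \<Rightarrow> bool" where
  "spanned_by j \<longleftrightarrow> (\<forall>S. vector_module n S \<longrightarrow> mixed_generators j S \<longrightarrow> M \<subseteq> S)"

lemma spanned_by_n: "spanned_by n"
  unfolding spanned_by_def
proof (intro allI impI)
  fix S assume S: "vector_module n S" and gen: "mixed_generators n S"
  show "M \<subseteq> S"
    unfolding B_span[symmetric]
  proof (rule span_mod_subset[OF S])
    fix f assume f: "\<And>k. k < n \<Longrightarrow> f k \<in> G n"
    show "f \<in> S"
    proof (rule vector_module_unit_vectors[OF S, of n])
      fix k assume "k < n"
      then show "(\<lambda>k'. if k' = k then f k else 0) \<in> S"
        using gen f[of k] by (simp add: mixed_generators_def)
    qed (auto dest: leD)
  next
    fix i x assume "i < n" "x \<in> \<bb> i"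
    then show "(\<lambda>k. x * B $$ (i, k)) \<in> S" using gen by (simp add: mixed_generators_def)
  qed
qed

text \<open>The universal property is applied to \<open>L\<close> itself: the rows
  \<open>\<bb> i * B_i\<close> with \<open>i < j\<close> are integral and vanish from column
  \<open>j\<close> on, so they lie in the part spanned by unit vectors.\<close>

lemma M_subset_completed:
  assumes "spanned_by j" and j: "j \<le> n"
  shows "M \<subseteq> row_span n (\<cc>' j) (W' j)"
proof -
  let ?L = "row_span n (\<cc>' j) (W' j)"
  have L: "vector_module n ?L" by (rule vector_module_row_span[OF c'_module])
  have base: "(\<lambda>k. x * W' j i k) \<in> ?L" if "i < n" "x \<in> \<cc>' j i" for x i
    by (rule row_span_base[where I = "\<cc>' j", OF c'_module that])
  have unit: "(\<lambda>k. if k = l then y else 0) \<in> ?L" if "l < j" "y \<in> ring_of_integers" for l y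
  proof -
    have "(\<lambda>k. y * W' j l k) = (\<lambda>k. if k = l then y else 0)" using that(1) by (auto simp: W'_def)
    then show ?thesis using base[of l y] that j by (simp add: \<cc>'_def)
  qed
  have "mixed_generators j ?L"
    unfolding mixed_generators_def
  proof (intro conjI allI ballI impI)
    fix i x assume i: "i < j" and x: "x \<in> \<bb> i"
    show "(\<lambda>k. x * B $$ (i, k)) \<in> ?L"
    proof (rule vector_module_unit_vectors[OF L, of j])
      fix k assume "k < j"
      then show "(\<lambda>k'. if k' = k then x * B $$ (i, k) else 0) \<in> ?L"
        using unit[of k "x * B $$ (i, k)"] bB_integral[of i k x] i x j by simp
    next
      fix k assume "j \<le> k" "k < n"
      then show "x * B $$ (i, k) = 0" using B_upper[of i k] i by simp
    qed
  next
    fix l y assume "l < j" "y \<in> G j"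
    then show "(\<lambda>k. if k = l then y else 0) \<in> ?L" using unit G_integral[OF j] by blast
  next
    fix l t assume l: "j \<le> l \<and> l < n" and t: "t \<in> \<cc> l"
    then show "(\<lambda>k. t * W l k) \<in> ?L" using base[of l t] by (simp add: \<cc>'_def W'_def)
  qed
  then show ?thesis using assms(1) L by (auto simp: spanned_by_def)
qed

lemma G_unit_in_M:
  assumes "spanned_by j" and "j \<le> n" and "l < j" and "y \<in> G j"
  shows "(\<lambda>k. if k = l then y else 0) \<in> M"
proof -
  have "(\<lambda>k. y * 1 * W' j l k) \<in> M"
    using assms by (intro G_mult_W'_in_M M_subset_completed) (auto simp: \<cc>'_def)
  moreover have "(\<lambda>k. y * 1 * W' j l k) = (\<lambda>k. if k = l then y else 0)"
    using assms(3) by (auto simp: W'_def)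
  ultimately show ?thesis by simp
qed

text \<open>\<open>t W_j\<close> splits as \<open>(t u) B_j\<close>, where \<open>t u\<close> lies
  in \<open>\<bb> j\<close>, plus \<open>t (W_j - u B_j)\<close>, whose entries lie in
  \<open>G (Suc j)\<close> and vanish after column \<open>j\<close>.\<close>

lemma cW_in_M:
  assumes sp: "spanned_by (Suc j)" and j: "j < n" and t: "t \<in> \<cc> j"
  shows "(\<lambda>k. t * W j k) \<in> M"
proof -
  have "(\<lambda>k. t * (W j k - u j * B $$ (j, k))) \<in> M"
  proof (rule vector_module_unit_vectors[OF M_module, of "Suc j"])
    fix k assume "k < Suc j"
    then show "(\<lambda>k'. if k' = k then t * (W j k - u j * B $$ (j, k)) else 0) \<in> M"
      using G_mult_c[OF j W_cong[OF j] t, of k] j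
      by (intro G_unit_in_M[OF sp]) (auto simp: mult.commute)
  next
    fix k assume "Suc j \<le> k" "k < n"
    then show "t * (W j k - u j * B $$ (j, k)) = 0" by (simp add: W_upper B_upper)
  qed
  from vector_module_add[OF M_module bB_in_M[OF j u_mult_c[OF j t]] this]
  show ?thesis by (simp add: algebra_simps)
qed

text \<open>The generators at level \<open>Suc j\<close> are recovered from those at level
  \<open>j\<close>. The pivot 1 of row \<open>j > 0\<close> forces \<open>\<bb> j\<close>, hence
  \<open>\<cc> j\<close>, to be integral, so \<open>G (Suc j)\<close> is contained in
  \<open>G j\<close>.\<close>

lemma spanned_by_step:
  assumes sp: "spanned_by (Suc j)" and j: "0 < j" "j < n"
  shows "spanned_by j"
  unfolding spanned_by_def
proof (intro allI impI)
  fix S assume S: "vector_module n S" and gen: "mixed_generators j S"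
  have genB: "(\<lambda>k. x * B $$ (i, k)) \<in> S" if "i < j" "x \<in> \<bb> i" for i x
    using gen that by (simp add: mixed_generators_def)
  have genG: "(\<lambda>k. if k = l then y else 0) \<in> S" if "l < j" "y \<in> G j" for l y
    using gen that by (simp add: mixed_generators_def)
  have genW: "(\<lambda>k. t * W l k) \<in> S" if "j \<le> l" "l < n" "t \<in> \<cc> l" for l t
    using gen that by (simp add: mixed_generators_def)
  have Gj: "integer_module (G j)" using j by (simp add: G_module)
  have b_int: "x \<in> ring_of_integers" if "x \<in> \<bb> j" for x
    using bB_integral[OF j(2,2) that] B_diag[OF j] by simp
  have c_int: "t \<in> ring_of_integers" if t: "t \<in> \<cc> j" for t
  proof -
    obtain x y where "t = x + y" "x \<in> \<bb> j" "y \<in> G (Suc j)"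
      using t unfolding c_eq[OF j(2)] by (rule set_plus_elim)
    then show ?thesis
      using b_int G_integral[of "Suc j" y] j by (simp add: ring_of_integers_add)
  qed
  have G_sub: "y \<in> G j" if y: "y \<in> G (Suc j)" for y
  proof -
    have "1 \<in> ideal_inverse (\<cc> j)" using c_int by (simp add: ideal_inverse_def)
    then show ?thesis using ideal_mult_memI[OF y] G_eq[OF j(2)] by fastforce
  qed
  have "mixed_generators (Suc j) S"
    unfolding mixed_generators_def
  proof (intro conjI allI ballI impI)
    fix i x assume i: "i < Suc j" and x: "x \<in> \<bb> i"
    show "(\<lambda>k. x * B $$ (i, k)) \<in> S"
    proof (cases "i = j")
      case False
      then show ?thesis using genB i x by simp
    next
      case True
      have xj: "x \<in> \<bb> j" using x True by simp
      have "(\<lambda>k. x * B $$ (j, k) - x * W j k) \<in> S"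
      proof (rule vector_module_unit_vectors[OF S, of j])
        fix k assume k: "k < j"
        \<comment> \<open>With \<open>u + v = 1\<close> this expression is the entry of
          \<open>x B_j - x W_j\<close>; thus row \<open>j\<close> of \<open>B\<close> may be traded
          for row \<open>j\<close> of \<open>W\<close> modulo \<open>G j\<close>.\<close>
        have "v j * (x * B $$ (j, k)) - x * (W j k - u j * B $$ (j, k)) \<in> G j"
          using k j xj
          by (intro integer_module_diff[OF Gj] integer_module_mult_right[OF Gj]
              integer_module_mult[OF Gj] v_in_G W_cong bB_integral b_int) auto
        moreover have "v j * (x * B $$ (j, k)) - x * (W j k - u j * B $$ (j, k))
            = (u j + v j) * (x * B $$ (j, k)) - x * W j k"
          by (simp add: algebra_simps)
        ultimately have "x * B $$ (j, k) - x * W j k \<in> G j" by (simp add: uv[OF j(2)])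
        then show "(\<lambda>k'. if k' = k then x * B $$ (j, k) - x * W j k else 0) \<in> S"
          by (rule genG[OF k])
      next
        fix k assume "j \<le> k" "k < n"
        then show "x * B $$ (j, k) - x * W j k = 0"
          using j by (cases "k = j") (simp_all add: B_diag W_diag B_upper W_upper)
      qed
      from vector_module_add[OF S this genW[OF order_refl j(2) b_in_c[OF j(2) xj]]]
      show ?thesis by (simp add: True)
    qed
  next
    fix l y assume l: "l < Suc j" and y: "y \<in> G (Suc j)"
    show "(\<lambda>k. if k = l then y else 0) \<in> S"
    proof (cases "l = j")
      case False
      then show ?thesis using genG l G_sub[OF y] by simp
    next
      case True
      \<comment> \<open>A generator \<open>b * e\<close> of the ideal containing \<open>u j\<close>
        contributes \<open>b * B $$ (j, k)\<close>, which is integral, times \<open>y * e\<close>,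
        which lies in \<open>G j\<close>.\<close>
      have yB: "y * z * B $$ (j, k) \<in> G j" if "z \<in> \<bb> j \<cdot>\<^sub>I ideal_inverse (\<cc> j)" "k < n" for z k
        using that(1)
      proof (induction rule: ideal_mult_induct)
        case (step z b e)
        have "y * e \<in> G j" using ideal_mult_memI[OF y step.hyps(3)] G_eq[OF j(2)] by simp
        then have "b * B $$ (j, k) * (y * e) \<in> G j"
          using bB_integral[OF j(2) that(2) step.hyps(2)] by (rule integer_module_mult[OF Gj, rotated])
        moreover have "y * (z + b * e) * B $$ (j, k) = y * z * B $$ (j, k) + b * B $$ (j, k) * (y * e)"
          by (simp add: algebra_simps)
        ultimately show ?case using step.IH by (simp add: integer_module_add[OF Gj])
      qed (simp add: integer_module_0[OF Gj])
      \<comment> \<open>The unit vector at \<open>j\<close> is obtained from \<open>y W_j\<close> by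
        removing the entries left of the pivot, all of which lie in \<open>G j\<close>.\<close>
      have "(\<lambda>k. if k < j then y * W j k else 0) \<in> S"
      proof (rule vector_module_unit_vectors[OF S, of j])
        fix k assume k: "k < j"
        have "y * u j * B $$ (j, k) + y * (W j k - u j * B $$ (j, k)) \<in> G j"
          using k j y
          by (intro integer_module_add[OF Gj] integer_module_mult[OF Gj] yB W_cong u
              G_integral[of "Suc j"]) auto
        then have "y * W j k \<in> G j" by (simp add: algebra_simps)
        then show "(\<lambda>k'. if k' = k then if k < j then y * W j k else 0 else 0) \<in> S"
          using genG[OF k] k by simp
      qed simp
      from vector_module_diff[OF S genW[OF order_refl j(2) G_Suc_in_c[OF j(2) y]] this]
      show ?thesis
      proof (rule vector_module_cong[OF S])
        fix k assume "k < n"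
        then show "(if k = l then y else 0) = y * W j k - (if k < j then y * W j k else 0)"
          using True j by (cases k j rule: linorder_cases) (simp_all add: W_diag W_upper)
      qed
    qed
  next
    fix l t assume "Suc j \<le> l \<and> l < n" "t \<in> \<cc> l"
    then show "(\<lambda>k. t * W l k) \<in> S" using genW by simp
  qed
  then show "M \<subseteq> S" using sp S by (simp add: spanned_by_def)
qed

lemma spanned_by:
  assumes "0 < j" and "j \<le> n"
  shows "spanned_by j"
  using assms(2,1)
proof (induction rule: inc_induct)
  case (step m)
  then show ?case by (auto intro: spanned_by_step[of m])
qed (rule spanned_by_n)

text \<open>Together with \<open>G_mult_c\<close>: the ideal \<open>G j\<close> is the quotient of \<open>G n\<close> by the product of the later \<open>\<cc> l\<close>.\<close>

lemma in_G_if_products: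
  assumes "j \<le> n"
    and "\<And>t. (\<And>l. j \<le> l \<Longrightarrow> l < n \<Longrightarrow> t l \<in> \<cc> l) \<Longrightarrow> x * (\<Prod>l\<in>{j..<n}. t l) \<in> G n"
  shows "x \<in> G j"
  using assms
proof (induction arbitrary: x rule: inc_induct)
  case base
  then show ?case by simp
next
  case (step j)
  have xc: "x * s \<in> G (Suc j)" if s: "s \<in> \<cc> j" for s
  proof (rule step.IH)
    fix t assume t: "\<And>l. Suc j \<le> l \<Longrightarrow> l < n \<Longrightarrow> t l \<in> \<cc> l"
    have "x * (\<Prod>l\<in>{j..<n}. (t(j := s)) l) \<in> G n"
      using t s by (intro step.prems) auto
    moreover have "(\<Prod>l\<in>{j..<n}. (t(j := s)) l) = s * (\<Prod>l\<in>{Suc j..<n}. t l)"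
      using \<open>j < n\<close> by (simp add: prod.atLeast_Suc_lessThan)
    ultimately show "x * s * (\<Prod>l\<in>{Suc j..<n}. t l) \<in> G n" by (simp add: mult.assoc)
  qed
  have Gj: "integer_module (G j)" using step.hyps by (simp add: G_module)
  have *: "x * z \<in> G j" if z: "z \<in> I \<cdot>\<^sub>I ideal_inverse (\<cc> j)" and I: "I \<subseteq> \<cc> j" for z I
    using z
  proof (induction rule: ideal_mult_induct)
    case (step z b e)
    have "x * b * e \<in> G j"
      unfolding G_eq[OF \<open>j < n\<close>] using step.hyps(2,3) I xc by (intro ideal_mult_memI) auto
    then show ?case
      using integer_module_add[OF Gj step.IH] by (simp add: distrib_left mult.assoc)
  qed (simp add: integer_module_0[OF Gj])
  \<comment> \<open>Splitting \<open>x\<close> by \<open>u j + v j = 1\<close> is where the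
    invertibility of \<open>\<cc> j\<close> enters.\<close>
  have "x * u j + x * v j \<in> G j"
    using b_in_c[OF \<open>j < n\<close>] G_Suc_in_c[OF \<open>j < n\<close>]
    by (intro integer_module_add[OF Gj] *[OF u] *[OF v]) (use \<open>j < n\<close> in auto)
  then show ?case using uv[OF \<open>j < n\<close>] by (simp flip: distrib_left)
qed

lemma row_span_c_W_subset: "row_span n \<cc> W \<subseteq> M"
proof (rule row_span_subset[OF M_module])
  fix l x assume "l < n" "x \<in> \<cc> l"
  then show "(\<lambda>k. x * W l k) \<in> M" by (intro cW_in_M spanned_by) auto
qed

text \<open>
  Row \<open>0\<close> is not a pivot row of Algorithm H, so its diagonal entry need not be \<open>1\<close>, and the argument
  for the other rows does not apply.
\<close>

lemma b0_B00_in_G: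
  assumes x: "x \<in> \<bb> 0"
  shows "x * B $$ (0, 0) \<in> G 1"
proof (rule in_G_if_products)
  \<comment> \<open>Row 0 of \<open>W\<close> is the first unit vector, so with the ideal
    \<open>J 0\<close> it spans exactly \<open>\<bb> 0 * B_0\<close>. The rows of the submodule thus
    form the matrix \<open>W\<close> of determinant 1.\<close>
  define J where "J l = (if l = 0 then B $$ (0, 0) *o \<bb> 0 else \<cc> l)" for l
  fix t assume t: "\<And>l. 1 \<le> l \<Longrightarrow> l < n \<Longrightarrow> t l \<in> \<cc> l"
  define t' where "t' = t(0 := x * B $$ (0, 0))"
  have "(\<Prod>l<n. t' l) * fdet n W \<in> fdet n A *o ideal_prod n \<aa>"
  proof (rule prod_fdet_mem)
    fix l z assume l: "l < n" and z: "z \<in> J l"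
    show "(\<lambda>k. z * W l k) \<in> M"
    proof (cases "l = 0")
      case True
      then obtain y where y: "y \<in> \<bb> 0" "z = B $$ (0, 0) * y"
        using z by (auto simp: J_def elt_set_times_def)
      show ?thesis
      proof (rule vector_module_cong[OF M_module bB_in_M[OF n y(1)]])
        fix k assume "k < n"
        then show "z * W l k = y * B $$ (0, k)"
          using n by (cases "k = 0") (simp_all add: True y(2) W_diag W_upper B_upper)
      qed
    next
      case False
      then show ?thesis using z l by (intro cW_in_M spanned_by) (auto simp: J_def)
    qed
  next
    fix l assume "l < n"
    then show "t' l \<in> J l"
      using t[of l] x by (cases "l = 0") (simp_all add: t'_def J_def mult.commute[of x] set_times_intro2)
  qed
  moreover have "fdet n W = 1" by (rule fdet_unitriangular) (simp_all add: W_upper W_diag)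
  moreover have "(\<Prod>l<n. t' l) = x * B $$ (0, 0) * (\<Prod>l\<in>{1..<n}. t l)"
    using n by (simp add: t'_def lessThan_atLeast0 prod.atLeast_Suc_lessThan)
  ultimately show "x * B $$ (0, 0) * (\<Prod>l\<in>{1..<n}. t l) \<in> G n" by (simp add: Gn)
qed (use n in simp)

text \<open>The induction is used down to level 1 only. There the remaining generators are multiples
  of the first unit vector by elements of \<open>G 1\<close>, which is contained in
  \<open>\<cc> 0\<close>.\<close>

lemma row_span_c_W: "row_span n \<cc> W = M"
proof (rule equalityI[OF row_span_c_W_subset])
  let ?N = "row_span n \<cc> W"
  have N: "vector_module n ?N" by (rule vector_module_row_span[OF c_module])
  have base: "(\<lambda>k. t * W l k) \<in> ?N" if "l < n" "t \<in> \<cc> l" for l t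
    by (rule row_span_base[where I = \<cc>, OF c_module that])
  have G1: "y \<in> G 1 \<Longrightarrow> y \<in> \<cc> 0" for y using G_Suc_in_c[OF n] by simp
  have "mixed_generators 1 ?N"
    unfolding mixed_generators_def
  proof (intro conjI allI ballI impI)
    fix i x assume i: "i < 1" and x: "x \<in> \<bb> i"
    then have "(\<lambda>k. x * B $$ (0, 0) * W 0 k) \<in> ?N"
      using n by (intro base G1 b0_B00_in_G) auto
    then show "(\<lambda>k. x * B $$ (i, k)) \<in> ?N"
    proof (rule vector_module_cong[OF N])
      fix k assume "k < n"
      then show "x * B $$ (i, k) = x * B $$ (0, 0) * W 0 k"
        using i by (cases "k = 0") (simp_all add: W_diag W_upper B_upper)
    qed
  next
    fix l y assume l: "l < (1::nat)" and y: "y \<in> G 1"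
    from base[OF n G1[OF y]] show "(\<lambda>k. if k = l then y else 0) \<in> ?N"
    proof (rule vector_module_cong[OF N])
      fix k assume "k < n"
      then show "(if k = l then y else 0) = y * W 0 k"
        using l by (cases "k = 0") (simp_all add: W_diag W_upper)
    qed
  next
    fix l t assume "1 \<le> l \<and> l < n" "t \<in> \<cc> l"
    then show "(\<lambda>k. t * W l k) \<in> ?N" using base by simp
  qed
  moreover have "spanned_by 1" using n by (intro spanned_by) auto
  ultimately show "M \<subseteq> ?N" using N by (simp add: spanned_by_def)
qed

end

section \<open>Combining Algorithms H and E\<close>

lemma pseudo_span_cong_row_span:
  assumes "row_span n I (\<lambda>i k. A $$ (i, k)) = row_span n J (\<lambda>i k. B $$ (i, k))"
  shows "pseudo_span n I A = pseudo_span n J B"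
  using assms by (simp add: pseudo_span_eq_row_span)

text \<open>Cramer's rule with the standard lattice as ambient module: the determinantal ideal of an
  integral module multiplies all integral vectors into it.\<close>

lemma det_row_span_subset:
  assumes a: "\<And>l. l < n \<Longrightarrow> integer_module (\<aa> l)"
    and int: "\<And>f k. f \<in> row_span n \<aa> A \<Longrightarrow> k < n \<Longrightarrow> f k \<in> ring_of_integers"
    and f: "\<And>k. k < n \<Longrightarrow> f k \<in> fdet n A *o ideal_prod n \<aa>"
  shows "f \<in> row_span n \<aa> A"
proof -
  define e :: "nat \<Rightarrow> nat \<Rightarrow> 'a" where "e l k = (if k = l then 1 else 0)" for l k
  let ?O = "\<lambda>_::nat. ring_of_integers :: 'a set"
  note V = vector_module_row_span[of n \<aa> A, OF a]
  have VO: "vector_module n (row_span n ?O e)"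
    by (rule vector_module_row_span) (rule integer_module_ring_of_integers)
  have unit: "(\<lambda>k. y * e l k) = (\<lambda>k. if k = l then y else 0)" for y l by (auto simp: e_def)
  have sub: "(\<lambda>k. z * A i k) \<in> row_span n ?O e" if i: "i < n" "z \<in> \<aa> i" for i z
  proof (rule vector_module_unit_vectors[OF VO, of n])
    fix l assume l: "l < n"
    have "z * A i l \<in> ring_of_integers"
      using int[OF row_span_base[where I = \<aa> and a = A, OF a i] l] .
    then have "(\<lambda>k. z * A i l * e l k) \<in> row_span n ?O e"
      by (intro row_span_base integer_module_ring_of_integers l)
    then show "(\<lambda>k. if k = l then z * A i l else 0) \<in> row_span n ?O e" by (simp only: unit)
  qed (auto dest: leD)
  have det: "fdet n e = 1" by (rule fdet_unitriangular) (simp_all add: e_def)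
  have "ideal_prod n ?O \<subseteq> ring_of_integers"
    by (rule ideal_prod_subset[OF integer_module_ring_of_integers]) (auto intro!: ring_of_integers_prod)
  then have one: "1 \<in> ideal_inverse (ideal_prod n ?O)" by (auto simp: ideal_inverse_def)
  show ?thesis
  proof (rule vector_module_unit_vectors[OF V, of n])
    fix l assume l: "l < n"
    have "(\<lambda>k. 1 * f l * 1 * e l k) \<in> row_span n \<aa> A"
      by (rule fdet_mult_row_mem_row_span[OF a integer_module_ring_of_integers sub det one f[OF l] l]) auto
    then show "(\<lambda>k. if k = l then f l else 0) \<in> row_span n \<aa> A" by (simp add: unit)
  qed (auto dest: leD)
qed

text \<open>The initial normalization preserves every product of ideal and row, and adding
  \<open>\<gg> O^n\<close> changes nothing by \<open>g_sub\<close>. The column condition holds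
  vacuously at the start.\<close>

lemma hnf_modulo_invariant:
  assumes K: "number_field TYPE('k::field_char_0)"
    and A: "A \<in> carrier_mat n n"
    and a: "\<And>l. l < n \<Longrightarrow> bounded_module (\<aa> l :: 'k set)"
    and g: "integer_module \<gg>"
    and g_sub: "\<And>f. (\<And>k. k < n \<Longrightarrow> f k \<in> \<gg>) \<Longrightarrow> f \<in> row_span n \<aa> (\<lambda>i k. A $$ (i, k))"
    and hnf: "hnf_modulo n A \<aa> \<gg> B \<bb>"
  shows "hnf_invariant n \<gg> (row_span n \<aa> (\<lambda>i k. A $$ (i, k))) B \<bb> \<and> reduced_from n 0 B"
proof -
  let ?M = "row_span n \<aa> (\<lambda>i k. A $$ (i, k))"
  obtain B0 \<bb>0 where B0: "B0 \<in> carrier_mat n n"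
    and norm: "\<And>i. i < n \<Longrightarrow> normalizes (\<aa> i) (row A i) (\<bb>0 i) (row B0 i)"
    and steps: "hnf_steps n \<gg> [(j, i). j \<leftarrow> rev [0..<n], i \<leftarrow> rev [0..<j]] (B0, \<bb>0) (B, \<bb>)"
    using hnf by (auto simp: hnf_modulo_def)
  have "\<exists>c. c \<noteq> 0 \<and> \<bb>0 i = c *o \<aa> i \<and> row B0 i = inverse c \<cdot>\<^sub>v row A i" if "i < n" for i
    using normalizes_scaling[OF K a[OF that] norm[OF that]] by blast
  then have "\<forall>i\<in>{..<n}. \<exists>c. c \<noteq> 0 \<and> \<bb>0 i = c *o \<aa> i \<and> row B0 i = inverse c \<cdot>\<^sub>v row A i" by simp
  from bchoice[OF this] obtain c where
    c: "\<forall>i\<in>{..<n}. c i \<noteq> 0 \<and> \<bb>0 i = c i *o \<aa> i \<and> row B0 i = inverse (c i) \<cdot>\<^sub>v row A i" ..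
  have entry: "B0 $$ (i, k) = inverse (c i) * A $$ (i, k)" if "i < n" "k < n" for i k
  proof -
    have "row B0 i $ k = (inverse (c i) \<cdot>\<^sub>v row A i) $ k" using c that by simp
    then show ?thesis using that A B0 by simp
  qed
  have b0: "bounded_module (\<bb>0 i)" if "i < n" for i
    using c that bounded_module_scale[OF K a[OF that]] by simp
  have am: "\<And>i. i < n \<Longrightarrow> integer_module (\<aa> i)" and b0m: "\<And>i. i < n \<Longrightarrow> integer_module (\<bb>0 i)"
    using a b0 by (simp_all add: bounded_module_integer_module)
  have V: "vector_module n ?M" by (rule vector_module_row_span[OF am])
  have V': "vector_module n (span_mod n \<gg> \<bb>0 B0)" by (rule vector_module_span_mod[OF g b0m])
  have "span_mod n \<gg> \<bb>0 B0 \<subseteq> ?M"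
  proof (rule span_mod_subset[OF V])
    fix i x assume i: "i < n" and "x \<in> \<bb>0 i"
    then obtain y where y: "y \<in> \<aa> i" "x = c i * y" using c by (auto simp: elt_set_times_def)
    have ci: "c i \<noteq> 0" using c i by simp
    show "(\<lambda>k. x * B0 $$ (i, k)) \<in> ?M"
    proof (rule vector_module_cong[OF V row_span_base[where I = \<aa>, OF am i y(1)]])
      fix k assume "k < n"
      then show "x * B0 $$ (i, k) = y * A $$ (i, k)" using ci by (simp add: entry[OF i] y(2))
    qed
  qed (rule g_sub)
  moreover have "?M \<subseteq> span_mod n \<gg> \<bb>0 B0"
  proof (rule row_span_subset[OF V'])
    fix i x assume i: "i < n" and x: "x \<in> \<aa> i"
    have "c i * x \<in> \<bb>0 i" using c i x by auto
    moreover have "x * A $$ (i, k) - c i * x * B0 $$ (i, k) \<in> \<gg>" if "k < n" for k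
    proof -
      have "c i \<noteq> 0" using c i by simp
      then have eq: "c i * x * B0 $$ (i, k) = x * A $$ (i, k)" by (simp add: entry[OF i that])
      show ?thesis unfolding eq by (simp add: integer_module_0[OF g])
    qed
    ultimately show "(\<lambda>k. x * A $$ (i, k)) \<in> span_mod n \<gg> \<bb>0 B0"
      by (intro span_mod_base[where I = \<bb>0 and x = "c i * x", OF g b0m i])
  qed
  ultimately have inv: "hnf_invariant n \<gg> ?M B0 \<bb>0"
    using B0 b0 by (simp add: hnf_invariant_def)
  show ?thesis
    by (rule hnf_steps_all_columns[OF K g steps order_refl inv]) (simp add: reduced_from_def)
qed

theorem proposition9:
  fixes n :: nat
    and A B W :: "'k::field_char_0 mat"
    and \<aa> \<bb> \<cc> :: "nat \<Rightarrow> 'k set"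
    and \<gg> :: "'k set"
    and M :: "'k vec set"
  assumes "number_field TYPE('k)"
    and "A \<in> carrier_mat n n"
    and "vec_space.rank n A = n"
    and "\<And>i. i < n \<Longrightarrow> fractional_ideal (\<aa> i)"
    and "M = pseudo_span n \<aa> A"
    and "M \<subseteq> integral_vecs n"
    and "\<gg> = det A *o ideal_prod n \<aa>"
    and "hnf_modulo n A \<aa> \<gg> B \<bb>"
    and "euclidean_reconstruction n B \<bb> \<gg> W \<cc>"
  shows "pseudo_span n \<cc> W = M"
proof (cases "n = 0")
  case True
  then show ?thesis by (simp add: assms(5) pseudo_span_def)
next
  case False
  let ?A = "\<lambda>i k. A $$ (i, k)" and ?W = "\<lambda>i k. W $$ (i, k)"
  have a: "\<And>l. l < n \<Longrightarrow> bounded_module (\<aa> l)"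
    by (rule bounded_module_fractional_ideal[OF assms(1,4)])
  then have am: "\<And>l. l < n \<Longrightarrow> integer_module (\<aa> l)" by (rule bounded_module_integer_module)
  have "A = mat n n (\<lambda>(i, k). ?A i k)" using assms(2) by auto
  then have g: "\<gg> = fdet n ?A *o ideal_prod n \<aa>" by (simp add: assms(7) fdet_def)
  have gm: "integer_module \<gg>" by (simp add: g integer_module_scale integer_module_ideal_prod)
  have int: "f k \<in> ring_of_integers" if "f \<in> row_span n \<aa> ?A" "k < n" for f k
  proof -
    have "vec n f \<in> integral_vecs n"
      using assms(5,6) that(1) by (auto simp: pseudo_span_eq_row_span)
    then show ?thesis using that(2) by (simp add: integral_vecs_def)
  qed
  have g_sub: "f \<in> row_span n \<aa> ?A" if "\<And>k. k < n \<Longrightarrow> f k \<in> \<gg>" for f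
    by (rule det_row_span_subset[where A = ?A and \<aa> = \<aa>]) (use am int that g in auto)
  have inv: "hnf_invariant n \<gg> (row_span n \<aa> ?A) B \<bb>" and red: "reduced_from n 0 B"
    using hnf_modulo_invariant[OF assms(1,2) a gm g_sub assms(8)] by blast+
  obtain G where G: "G n = \<gg>" and G_rec: "\<forall>j<n. \<cc> j = \<bb> j + G (Suc j) \<and>
      G j = G (Suc j) \<cdot>\<^sub>I ideal_inverse (\<cc> j) \<and>
      (\<exists>u v. u \<in> \<bb> j \<cdot>\<^sub>I ideal_inverse (\<cc> j) \<and> v \<in> G (Suc j) \<cdot>\<^sub>I ideal_inverse (\<cc> j) \<and>
        u + v = 1 \<and> (\<forall>k<n. k \<noteq> j \<longrightarrow> reduces (G j) (u * B $$ (j, k)) (W $$ (j, k))) \<and>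
        W $$ (j, j) = 1 \<and> u * B $$ (j, j) - 1 \<in> G j)"
    using assms(9) unfolding euclidean_reconstruction_def by (elim conjE exE)
  have rec: "\<And>j. j < n \<Longrightarrow> \<cc> j = \<bb> j + G (Suc j)"
      "\<And>j. j < n \<Longrightarrow> G j = G (Suc j) \<cdot>\<^sub>I ideal_inverse (\<cc> j)"
      "\<forall>j\<in>{..<n}. \<exists>u v. u \<in> \<bb> j \<cdot>\<^sub>I ideal_inverse (\<cc> j) \<and> v \<in> G (Suc j) \<cdot>\<^sub>I ideal_inverse (\<cc> j) \<and>
        u + v = 1 \<and> (\<forall>k<n. k \<noteq> j \<longrightarrow> reduces (G j) (u * B $$ (j, k)) (W $$ (j, k))) \<and>
        W $$ (j, j) = 1 \<and> u * B $$ (j, j) - 1 \<in> G j"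
    using G_rec by blast+
  from bchoice[OF rec(3)] obtain u where u: "\<forall>j\<in>{..<n}. \<exists>v. u j \<in> \<bb> j \<cdot>\<^sub>I ideal_inverse (\<cc> j) \<and>
        v \<in> G (Suc j) \<cdot>\<^sub>I ideal_inverse (\<cc> j) \<and>
        u j + v = 1 \<and> (\<forall>k<n. k \<noteq> j \<longrightarrow> reduces (G j) (u j * B $$ (j, k)) (W $$ (j, k))) \<and>
        W $$ (j, j) = 1 \<and> u j * B $$ (j, j) - 1 \<in> G j" ..
  from bchoice[OF u] obtain v where uv: "\<forall>j\<in>{..<n}. u j \<in> \<bb> j \<cdot>\<^sub>I ideal_inverse (\<cc> j) \<and>
        v j \<in> G (Suc j) \<cdot>\<^sub>I ideal_inverse (\<cc> j) \<and>
        u j + v j = 1 \<and> (\<forall>k<n. k \<noteq> j \<longrightarrow> reduces (G j) (u j * B $$ (j, k)) (W $$ (j, k))) \<and>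
        W $$ (j, j) = 1 \<and> u j * B $$ (j, j) - 1 \<in> G j" ..
  interpret reconstruction n ?A ?W B \<aa> \<bb> \<cc> G u v
  proof
    show "0 < n" using False by simp
    show "\<And>l. l < n \<Longrightarrow> integer_module (\<bb> l)" "span_mod n (G n) \<bb> B = row_span n \<aa> ?A"
      using inv G by (simp_all add: hnf_invariant_def bounded_module_integer_module)
    show upper: "B $$ (i, j) = 0" if "i < j" "j < n" for i j
      using red that by (simp add: reduced_from_def)
    show "B $$ (j, j) = 1" if "0 < j" "j < n" for j
      using red that by (simp add: reduced_from_def)
    show "G n = fdet n ?A *o ideal_prod n \<aa>" using G g by simp
    show "W $$ (j, k) - u j * B $$ (j, k) \<in> G j" if "j < n" "k < n" for j k
    \<comment> \<open>On the diagonal, Algorithm E imposes a congruence instead of a reduction, so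
      the two cases need different arguments.\<close>
    proof (cases "k = j")
      case True
      have Gj: "integer_module (G j)"
        using rec(2)[OF that(1)] by (simp add: integer_module_ideal_mult integer_module_inverse)
      have "u j * B $$ (j, j) - 1 \<in> G j" "W $$ (j, j) = 1" using uv that(1) by auto
      then show ?thesis using integer_module_uminus[OF Gj, of "u j * B $$ (j, j) - 1"] True by simp
    next
      case False
      have "integer_module (G j)"
        using rec(2)[OF that(1)] by (simp add: integer_module_ideal_mult integer_module_inverse)
      then show ?thesis using uv that False by (intro reduces_diff) auto
    qed
    show "W $$ (i, j) = 0" if "i < j" "j < n" for i j
    proof -
      \<comment> \<open>The entry being reduced is \<open>u i * 0\<close>, because \<open>B\<close>
        already vanishes above the diagonal.\<close>
      have "reduces (G i) (u i * B $$ (i, j)) (W $$ (i, j))" using uv that by auto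
      then show ?thesis using upper[OF that] by (simp add: reduces_0)
    qed
  qed (use am int rec(1,2) uv in auto)
  show ?thesis
    unfolding assms(5) by (rule pseudo_span_cong_row_span[OF row_span_c_W])
qed

end
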